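(* For any $(a,b,c,\lambda,\delta)\in(\mathbb F^\times)^4\times\mathbb F$ the following are equivalent: (i) the $\triangle_q$-module $W_\lambda^\delta(a,b,c)$ is irreducible; (ii) for every $(\bar a,\bar b,\bar c,\bar\lambda,\bar\delta)\in(\mathbb F^\times)^4\times\mathbb F$ with $(\bar a,\bar b,\bar c,\bar\lambda,\bar\delta)\simeq_{\pm,\mathfrak S_4}(a,b,c,\lambda,\delta)$, one has $\bar\delta\ne0$ or $\bar\lambda^2\notin\{q^{2i}: i=0,1,\dots,d'-2\}$.
   Context: $\mathbb F$ is an algebraically closed field and $q\in\mathbb F^\times$ is a root of unity of order $d$ with $d\notin\{1,2,4\}$; $d'=d$ if $d$ is odd and $d'=d/2$ if $d$ is even. For $x\in\mathbb F$, $\sqrt{x}$ denotes a fixed root of $t^2-x$. The universal Askey–Wilson algebra $\triangle_q$ is the unital associative $\mathbb F$-algebra with generators $A,B,C$ subject to: each of $A+\frac{qBC-q^{-1}CB}{q^2-q^{-2}}$, $B+\frac{qCA-q^{-1}AC}{q^2-q^{-2}}$, $C+\frac{qAB-q^{-1}BA}{q^2-q^{-2}}$ is central; $\alpha,\beta,\gamma$ denote these multiplied by $q+q^{-1}$. For $(a,b,c,\lambda)\in(\mathbb F^\times)^4$ and $i\in\mathbb N$ set $\theta_i=a\lambda^{-1}q^{2i}+a^{-1}\lambda q^{-2i}$, $\theta_i^*=b\lambda^{-1}q^{2i}+b^{-1}\lambda q^{-2i}$, $\varphi_i=a^{-1}b^{-1}\lambda q(q^i-q^{-i})(\lambda^{-1}q^{i-1}-\lambda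 q^{1-i})(q^{-i}-abc\lambda^{-1}q^{i-1})(q^{-i}-abc^{-1}\lambda^{-1}q^{i-1})$. $M_\lambda(a,b,c)$ is the $\triangle_q$-module with basis $\{m_i\}_{i\in\mathbb N}$, $(A-\theta_i)m_i=m_{i+1}$, $(B-\theta_i^* )m_i=\varphi_im_{i-1}$, and $\alpha,\beta,\gamma$ acting as $(b+b^{-1})(c+c^{-1})+(a+a^{-1})(\lambda q+\lambda^{-1}q^{-1})$, $(c+c^{-1})(a+a^{-1})+(b+b^{-1})(\lambda q+\lambda^{-1}q^{-1})$, $(a+a^{-1})(b+b^{-1})+(c+c^{-1})(\lambda q+\lambda^{-1}q^{-1})$. For $\delta\in\mathbb F$, $W_\lambda^\delta(a,b,c)$ is the quotient of $M_\lambda(a,b,c)$ by the submodule spanned by $\{\delta m_i-m_{d'+i}\}_{i\in\mathbb N}$. The group $\{\pm1\}$ acts on $(\mathbb F^\times)^4$ by $(-1)\cdot(a,b,c,\lambda)=(-a,-b,-c,-\lambda)$. The symmetric group $\mathfrak S_4$ acts on the right on the set of $\{\pm1\}$-orbits by $[a,b,c,\lambda](1\,2)=[a,b,c^{-1},\lambda]$, $[a,b,c,\lambda](3\,4)=[a^{-1},b,c,\lambda]$, $[a,b,c,\lambda](2\,3)=[\frac{a}{s},\frac{b}{s},\frac{c}{s},\frac{\lambda}{s}]$ with $s=\sqrt{abc\lambda q}$, where $[\cdot]$ denotes the $\{\pm1\}$-orbit. Write $(a,b,c,\lambda)\approx(\bar a,\bar b,\bar c,\bar\lambda)$ if their $\{\pm1\}$-orbits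 lie in the same $\mathfrak S_4$-orbit. For quintuples, $(a,b,c,\lambda,\delta)\simeq_{\pm,\mathfrak S_4}(\bar a,\bar b,\bar c,\bar\lambda,\bar\delta)$ means $(a,b,c,\lambda)\approx(\bar a,\bar b,\bar c,\bar\lambda)$ and $\delta+a^{d'}\lambda^{-d'}+a^{-d'}\lambda^{d'}=\bar\delta+\bar a^{d'}\bar\lambda^{-d'}+\bar a^{-d'}\bar\lambda^{d'}$. *)

theory Defs
  imports Main "HOL-Computational_Algebra.Polynomial"
begin

definition alg_closed_field :: "'a::field itself \<Rightarrow> bool" where
  "alg_closed_field _ \<longleftrightarrow> (\<forall>p::'a poly. degree p \<noteq> 0 \<longrightarrow> (\<exists>x. poly p x = 0))"

definition root_of_unity_order :: "'a::field \<Rightarrow> nat \<Rightarrow> bool" where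
  "root_of_unity_order q d \<longleftrightarrow> 0 < d \<and> q ^ d = 1 \<and> (\<forall>k. 0 < k \<and> k < d \<longrightarrow> q ^ k \<noteq> 1)"

definition dprime :: "nat \<Rightarrow> nat" where
  "dprime d = (if even d then d div 2 else d)"

definition theta :: "'a::field \<Rightarrow> 'a \<Rightarrow> 'a \<Rightarrow> nat \<Rightarrow> 'a" where
  "theta q a lam i = a * inverse lam * q powi (2 * int i) + inverse a * lam * q powi (- 2 * int i)"

(* theta^*_i = theta q b lam i *)

definition phi :: "'a::field \<Rightarrow> 'a \<Rightarrow> 'a \<Rightarrow> 'a \<Rightarrow> 'a \<Rightarrow> nat \<Rightarrow> 'a" where
  "phi q a b c lam i =
     inverse a * inverse b * lam * q
     * (q powi int i - q powi (- int i))
     * (inverse lam * q powi (int i - 1) - lam * q powi (1 - int i))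
     * (q powi (- int i) - a * b * c * inverse lam * q powi (int i - 1))
     * (q powi (- int i) - a * b * inverse c * inverse lam * q powi (int i - 1))"

(* scalar by which gamma acts *)
definition gam :: "'a::field \<Rightarrow> 'a \<Rightarrow> 'a \<Rightarrow> 'a \<Rightarrow> 'a \<Rightarrow> 'a" where
  "gam q a b c lam = (a + inverse a) * (b + inverse b) + (c + inverse c) * (lam * q + inverse lam * inverse q)"

(* Vectors of M_lambda(a,b,c): finitely supported coefficient sequences w.r.t. basis m_0, m_1, ... *)
definition Mspace :: "(nat \<Rightarrow> 'a::zero) set" where
  "Mspace = {v. finite {i. v i \<noteq> 0}}"

definition mbasis :: "nat \<Rightarrow> nat \<Rightarrow> 'a::{zero,one}" where
  "mbasis i = (\<lambda>j. if j = i then 1 else 0)"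

(* (A - theta_i) m_i = m_{i+1} *)
definition actA :: "'a::field \<Rightarrow> 'a \<Rightarrow> 'a \<Rightarrow> (nat \<Rightarrow> 'a) \<Rightarrow> (nat \<Rightarrow> 'a)" where
  "actA q a lam v = (\<lambda>i. theta q a lam i * v i + (if i = 0 then 0 else v (i - 1)))"

(* (B - theta^*_i) m_i = phi_i m_{i-1} *)
definition actB :: "'a::field \<Rightarrow> 'a \<Rightarrow> 'a \<Rightarrow> 'a \<Rightarrow> 'a \<Rightarrow> (nat \<Rightarrow> 'a) \<Rightarrow> (nat \<Rightarrow> 'a)" where
  "actB q a b c lam v = (\<lambda>i. theta q b lam i * v i + phi q a b c lam (Suc i) * v (Suc i))"

(* C is determined by the centrality relation: gamma = (q+q^{-1})(C + (qAB - q^{-1}BA)/(q^2-q^{-2})) *)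
definition actC :: "'a::field \<Rightarrow> 'a \<Rightarrow> 'a \<Rightarrow> 'a \<Rightarrow> 'a \<Rightarrow> (nat \<Rightarrow> 'a) \<Rightarrow> (nat \<Rightarrow> 'a)" where
  "actC q a b c lam v = (\<lambda>i.
      gam q a b c lam / (q + inverse q) * v i
      - (q * actA q a lam (actB q a b c lam v) i - inverse q * actB q a b c lam (actA q a lam v) i)
        / (q ^ 2 - inverse q ^ 2))"

definition is_subspace :: "(nat \<Rightarrow> 'a::field) set \<Rightarrow> bool" where
  "is_subspace U \<longleftrightarrow> U \<subseteq> Mspace \<and> (\<lambda>_. 0) \<in> U
     \<and> (\<forall>u\<in>U. \<forall>w\<in>U. (\<lambda>i. u i + w i) \<in> U)
     \<and> (\<forall>t. \<forall>u\<in>U. (\<lambda>i. t * u i) \<in> U)"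

definition lspan :: "(nat \<Rightarrow> 'a::field) set \<Rightarrow> (nat \<Rightarrow> 'a) set" where
  "lspan S = \<Inter>{U. is_subspace U \<and> S \<subseteq> U}"

definition is_submodule :: "'a::field \<Rightarrow> 'a \<Rightarrow> 'a \<Rightarrow> 'a \<Rightarrow> 'a \<Rightarrow> (nat \<Rightarrow> 'a) set \<Rightarrow> bool" where
  "is_submodule q a b c lam U \<longleftrightarrow> is_subspace U
     \<and> (\<forall>u\<in>U. actA q a lam u \<in> U \<and> actB q a b c lam u \<in> U \<and> actC q a b c lam u \<in> U)"

definition Nsub :: "nat \<Rightarrow> 'a::field \<Rightarrow> (nat \<Rightarrow> 'a) set" where
  "Nsub d' del = lspan {(\<lambda>j. del * mbasis i j - mbasis (d' + i) j) | i. True}"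

(* W = M / N is irreducible iff N is a maximal proper submodule of M (correspondence theorem) *)
definition W_irreducible :: "'a::field \<Rightarrow> nat \<Rightarrow> 'a \<Rightarrow> 'a \<Rightarrow> 'a \<Rightarrow> 'a \<Rightarrow> 'a \<Rightarrow> bool" where
  "W_irreducible q d' a b c lam del \<longleftrightarrow>
     Nsub d' del \<noteq> Mspace \<and>
     (\<forall>U. is_submodule q a b c lam U \<and> Nsub d' del \<subseteq> U \<longrightarrow> U = Nsub d' del \<or> U = Mspace)"

(* generators of the {+-1} x S_4 action on quadruples *)
inductive gen_step :: "'a::field \<Rightarrow> 'a \<times> 'a \<times> 'a \<times> 'a \<Rightarrow> 'a \<times> 'a \<times> 'a \<times> 'a \<Rightarrow> bool"
  for q where
  sign: "gen_step q (a, b, c, lam) (- a, - b, - c, - lam)"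
| t12: "gen_step q (a, b, c, lam) (a, b, inverse c, lam)"
| t34: "gen_step q (a, b, c, lam) (inverse a, b, c, lam)"
| t23: "s * s = a * b * c * lam * q \<Longrightarrow> gen_step q (a, b, c, lam) (a / s, b / s, c / s, lam / s)"

definition quad_equiv :: "'a::field \<Rightarrow> 'a \<times> 'a \<times> 'a \<times> 'a \<Rightarrow> 'a \<times> 'a \<times> 'a \<times> 'a \<Rightarrow> bool" where
  "quad_equiv q x y \<longleftrightarrow> (sup (gen_step q) (gen_step q)\<inverse>\<inverse>)\<^sup>*\<^sup>* x y"

definition quint_equiv :: "'a::field \<Rightarrow> nat \<Rightarrow> 'a \<times> 'a \<times> 'a \<times> 'a \<times> 'a \<Rightarrow> 'a \<times> 'a \<times> 'a \<times> 'a \<times> 'a \<Rightarrow> bool" where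
  "quint_equiv q d' x y \<longleftrightarrow>
     (case x of (a, b, c, lam, del) \<Rightarrow> case y of (a', b', c', lam', del') \<Rightarrow>
       quad_equiv q (a, b, c, lam) (a', b', c', lam')
       \<and> del + a ^ d' * inverse lam ^ d' + inverse a ^ d' * lam ^ d'
         = del' + a' ^ d' * inverse lam' ^ d' + inverse a' ^ d' * lam' ^ d')"

end

(* Write Q = q^2 and n = d'. Sending m_i to the monic polynomial with roots theta_0, ..., theta_{i-1}
   identifies M_lambda(a,b,c) with F[X], where A acts as multiplication by X and, after the
   substitution X = z + 1/z, B acts as an Askey-Wilson q-difference operator. That operator depends
   only on mu = b/lambda and on the multiset of the four parameters
   x = (bq/c, bcq, 1/(a lambda), a/lambda), and the submodule defining W is the ideal generated by
   P(z + 1/z) = z^n + z^(-n) - kappa with kappa = delta + (a/lambda)^n + (lambda/a)^n.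
   The generators (1 2), (2 3), (3 4) transpose adjacent entries of x and fix mu, so irreducibility
   is invariant under the equivalence. W is reducible iff P has a proper factor g whose ideal is
   stable under the operator. With m = deg g, stability makes z^m g(z + 1/z) divide the product of the 1 - x_i z
   times the q-difference of g; since that difference has smaller degree, at least two of the
   1/x_i are roots of z^m g(z + 1/z), and some two of them satisfy x_i x_j Q^k = 1 with k <= n - 2
   and x_i^n + x_i^(-n) = kappa. Moving x_i, x_j to the last two positions gives lambda^2 = Q^k and
   delta = 0, the case in which phi_{k+1} = 0 and a submodule is visible. *)

theory Submission
  imports Defs
begin

section \<open>Polynomials\<close>

text \<open>The delicate point is the bound k \<le> n - 2. The excluded k = n - 1 means x_i x_j = Q.
  It concerns phi_n, which vanishes for all parameters since Q^n = 1, and the subspace it exposes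
  for delta = 0 is N itself. So two common roots are not enough: they must avoid the product Q.
  Write kappa = s + 1/s; every root z of g(z + 1/z) has z^n = s or z^n = 1/s. If s^2 \<noteq> 1, the
  orbit of z under multiplication by Q gives n different values z + 1/z, more than deg g, so in each
  class some root z is followed by a non-root Q z; there the q-difference is nonzero and 1/z is a
  parameter. The pair from the two classes cannot have product Q, as Q z would be the inverse of the
  other root. If s^2 = 1, orbits are closed under inversion and this argument fails. The degree
  count then gives parameters with multiplicity. If all pairs had product Q, exactly two would force
  the q-difference of g to vanish, and three or more would coincide and give a triple root of (z^n -
  s)^2.\<close>

lemma alg_closed_infinite:
  assumes "alg_closed_field TYPE('a::field)"
  shows "infinite (UNIV :: 'a set)"
proof
  assume fin: "finite (UNIV :: 'a set)"
  define f :: "'a poly" where "f = 1 + (\<Prod>c\<in>UNIV. [:- c, 1:])"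
  have val: "poly f x = 1" for x
  proof -
    have "(\<Prod>c\<in>UNIV. x - c) = 0"
      using fin by (intro prod_zero) auto
    then show ?thesis by (simp add: f_def poly_prod)
  qed
  have "degree f = 0"
    using assms val unfolding alg_closed_field_def by (metis zero_neq_one)
  then obtain k where "f = [:k:]" by (rule degree_eq_zeroE)
  with val[of 0] have "f = 1" by (simp add: one_pCons)
  then have "(\<Prod>c\<in>UNIV. [:- c, 1::'a:]) = 0" by (simp add: f_def)
  then show False using fin by simp
qed

lemma poly_eqI_infinite:
  fixes f g :: "'a::idom poly"
  assumes "infinite S" and "\<And>z. z \<in> S \<Longrightarrow> poly f z = poly g z"
  shows "f = g"
proof (rule ccontr)
  assume "f \<noteq> g"
  then have "finite {z. poly (f - g) z = 0}" by (intro poly_roots_finite) simp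
  moreover have "S \<subseteq> {z. poly (f - g) z = 0}" using assms(2) by auto
  ultimately show False using assms(1) finite_subset by blast
qed

section \<open>Divisibility by products of linear factors 1 - x z\<close>

lemma linear_dvd_iff:
  fixes x :: "'a::field"
  assumes "x \<noteq> 0"
  shows "[:1, - x:] dvd f \<longleftrightarrow> poly f (inverse x) = 0"
proof -
  have eq: "[:1, - x:] = smult (- x) [:- inverse x, 1:]"
    using assms by simp
  show ?thesis
    unfolding eq smult_dvd_iff poly_eq_0_iff_dvd using assms by auto
qed

lemma dvd_linear_mult_cases:
  fixes x :: "'a::field"
  assumes "x \<noteq> 0" and "f dvd [:1, - x:] * h"
  shows "f dvd h \<or> (\<exists>f'. f = [:1, - x:] * f' \<and> f' dvd h)"
proof (cases "[:1, - x:] dvd f")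
  case True
  then obtain f' where f': "f = [:1, - x:] * f'" by (elim dvdE)
  then have "f' dvd h" using assms by (simp only: f' dvd_mult_cancel_left) simp
  with f' show ?thesis by blast
next
  case False
  from assms(2) obtain k where k: "[:1, - x:] * h = f * k" by (elim dvdE)
  then have "[:1, - x:] dvd f * k" by (metis dvd_triv_left)
  then have "[:1, - x:] dvd k"
    using False unfolding linear_dvd_iff[OF assms(1)] by simp
  then obtain k' where "k = [:1, - x:] * k'" by (elim dvdE)
  with k have "[:1, - x:] * h = [:1, - x:] * (f * k')" by (simp only: ac_simps)
  then have "h = f * k'" by (simp only: mult_cancel_left) simp
  then show ?thesis by simp
qed

text \<open>Since w divides h, for nonzero h the set J has at least deg f - deg h elements: this
  turns a degree bound into a number of parameters, counted with multiplicity.\<close>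

lemma dvd_prod_linear_mult_split:
  fixes x :: "nat \<Rightarrow> 'a::field"
  assumes "finite I" and "\<And>i. i \<in> I \<Longrightarrow> x i \<noteq> 0"
    and "f dvd (\<Prod>i\<in>I. [:1, - x i:]) * h"
  shows "\<exists>J w. J \<subseteq> I \<and> f = (\<Prod>i\<in>J. [:1, - x i:]) * w \<and> w dvd h"
  using assms
proof (induction I arbitrary: f rule: finite_induct)
  case empty
  then show ?case by (intro exI[of _ "{}"] exI[of _ f]) simp
next
  case (insert i I)
  have IH: "\<exists>J w. J \<subseteq> I \<and> f = (\<Prod>i\<in>J. [:1, - x i:]) * w \<and> w dvd h"
    if "f dvd (\<Prod>i\<in>I. [:1, - x i:]) * h" for f
    using that insert.prems(1) by (intro insert.IH) auto
  have dvd: "f dvd [:1, - x i:] * ((\<Prod>i\<in>I. [:1, - x i:]) * h)"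
    using insert.prems(2) unfolding prod.insert[OF insert.hyps(1,2)] mult.assoc .
  have "x i \<noteq> 0" using insert.prems by simp
  from dvd_linear_mult_cases[OF this dvd] consider "f dvd (\<Prod>i\<in>I. [:1, - x i:]) * h"
    | f' where "f = [:1, - x i:] * f'" "f' dvd (\<Prod>i\<in>I. [:1, - x i:]) * h"
    by blast
  then show ?case
  proof cases
    case 1
    from IH[OF this] obtain J w
      where "J \<subseteq> I" "f = (\<Prod>i\<in>J. [:1, - x i:]) * w" "w dvd h" by blast
    then show ?thesis by blast
  next
    case 2
    from IH[OF 2(2)] obtain J w
      where J: "J \<subseteq> I" "f' = (\<Prod>i\<in>J. [:1, - x i:]) * w" "w dvd h" by blast
    moreover have "finite J" "i \<notin> J" using J insert.hyps finite_subset by blast+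
    ultimately have "f = (\<Prod>j\<in>insert i J. [:1, - x j:]) * w"
      using 2(1) unfolding prod.insert[OF \<open>finite J\<close> \<open>i \<notin> J\<close>] by (simp only: mult.assoc)
    moreover have "insert i J \<subseteq> insert i I" using J by blast
    ultimately show ?thesis using J by blast
  qed
qed

lemma dvd_power_X_mult_cancel:
  fixes f :: "'a::field poly"
  assumes "poly f 0 \<noteq> 0" and "f dvd [:0, 1:] ^ k * h"
  shows "f dvd h"
  using assms(2)
proof (induction k)
  case (Suc k)
  then obtain g where g: "[:0, 1:] * ([:0, 1:] ^ k * h) = f * g"
    by (metis dvdE mult.assoc power_Suc)
  then have "poly (f * g) 0 = 0" by (metis poly_mult poly_pCons mult_zero_left add_0)
  then have "poly g 0 = 0" using assms(1) by simp
  then obtain g' where "g = [:0, 1:] * g'"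
    using poly_eq_0_iff_dvd[of g 0] by (auto elim: dvdE)
  with g have "[:0, 1:] * ([:0, 1:] ^ k * h) = [:0, 1:] * (f * g')"
    by (simp only: ac_simps)
  then have "[:0, 1:] ^ k * h = f * g'" by (simp only: mult_cancel_left) simp
  then show ?case using Suc.IH by simp
qed simp

text \<open>F clears the denominator of f(z + 1/z), so its two end coefficients are both the top
  coefficient of f. The difference is divisible by Q z^2 - 1 because Q z = 1/z where Q z^2 = 1.
  Asking only for degree at most k allows several polynomials to be cleared with one
  exponent.\<close>

lemma hat_poly_exists:
  fixes f :: "'a::field poly" and Q :: 'a
  assumes "degree f \<le> k" and "Q \<noteq> 0"
  shows "\<exists>F r. (\<forall>z. z \<noteq> 0 \<longrightarrow> poly F z = z ^ k * poly f (z + inverse z))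
    \<and> poly F 0 = coeff f k \<and> coeff F (2 * k) = coeff f k \<and> degree F \<le> 2 * k
    \<and> (\<forall>z. z \<noteq> 0 \<longrightarrow> (Q * z\<^sup>2 - 1) * poly r z
           = z ^ k * (poly f (Q * z + inverse (Q * z)) - poly f (z + inverse z)))"
  using assms(1)
proof (induction k arbitrary: f)
  case 0
  then obtain c where "f = [:c:]" by (metis degree_eq_zeroE le_zero_eq)
  then show ?case by (intro exI[of _ "[:c:]"] exI[of _ 0]) simp
next
  case (Suc k)
  obtain c f' where f: "f = pCons c f'" by (cases f)
  then have "degree f' \<le> k" using Suc.prems by (cases "f' = 0") auto
  from Suc.IH[OF this] obtain F r where
    F: "\<And>z. z \<noteq> 0 \<Longrightarrow> poly F z = z ^ k * poly f' (z + inverse z)"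
    and F0: "poly F 0 = coeff f' k" and Fk: "coeff F (2 * k) = coeff f' k"
    and dF: "degree F \<le> 2 * k"
    and r: "\<And>z. z \<noteq> 0 \<Longrightarrow> (Q * z\<^sup>2 - 1) * poly r z
           = z ^ k * (poly f' (Q * z + inverse (Q * z)) - poly f' (z + inverse z))"
    by metis
  define F' where "F' = monom c (Suc k) + [:1, 0, 1:] * F"
  \<comment> \<open>Product rule for the difference: Y U - X V = Y (U - V) + (Y - X) V with X = z +
    1/z and Y = Q z + 1/(Q z). Here z Y = Q z^2 + 1/Q, and z (Y - X) = (Q z^2 - 1) (Q - 1) / Q
    supplies the required factor.\<close>
  define r' where "r' = [:inverse Q, 0, Q:] * r + smult ((Q - 1) * inverse Q) F"
  have "poly F' z = z ^ Suc k * poly f (z + inverse z)" if "z \<noteq> 0" for z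
    using that by (simp add: F'_def f poly_monom F field_simps)
  moreover have "poly F' 0 = coeff f (Suc k)" by (simp add: F'_def f poly_monom F0)
  moreover have "coeff F (2 * k + 2) = 0" using dF by (intro coeff_eq_0) simp
  then have "coeff F' (2 * Suc k) = coeff f (Suc k)"
    by (simp add: F'_def f Fk)
  moreover have "degree F' \<le> 2 * Suc k"
  proof -
    have "degree ([:1, 0, 1:] * F) \<le> degree [:1, 0, 1 :: 'a:] + degree F" by (rule degree_mult_le)
    also have "\<dots> \<le> 2 * Suc k" using dF by simp
    finally have "degree ([:1, 0, 1:] * F) \<le> 2 * Suc k" .
    moreover have "degree (monom c (Suc k)) \<le> 2 * Suc k"
      using degree_monom_le[of c "Suc k"] by simp
    ultimately show ?thesis unfolding F'_def by (rule degree_add_le[rotated])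
  qed
  moreover have "(Q * z\<^sup>2 - 1) * poly r' z
      = z ^ Suc k * (poly f (Q * z + inverse (Q * z)) - poly f (z + inverse z))"
    if z: "z \<noteq> 0" for z
  proof -
    define U where "U = poly f' (Q * z + inverse (Q * z))"
    define V where "V = poly f' (z + inverse z)"
    have "(Q * z\<^sup>2 - 1) * poly r' z
        = (inverse Q + Q * z\<^sup>2) * ((Q * z\<^sup>2 - 1) * poly r z)
          + (Q * z\<^sup>2 - 1) * ((Q - 1) * inverse Q) * poly F z"
      by (simp add: r'_def algebra_simps power2_eq_square)
    also have "\<dots> = z ^ k * ((inverse Q + Q * z\<^sup>2) * (U - V)
          + (Q * z\<^sup>2 - 1) * ((Q - 1) * inverse Q) * V)"
      unfolding r[OF z] F[OF z] U_def[symmetric] V_def[symmetric] by (simp add: algebra_simps)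
    also have "(inverse Q + Q * z\<^sup>2) * (U - V) + (Q * z\<^sup>2 - 1) * ((Q - 1) * inverse Q) * V
        = z * ((Q * z + inverse (Q * z)) * U - (z + inverse z) * V)"
      using z assms(2) by (simp add: field_simps power2_eq_square)
    finally show ?thesis
      by (simp add: f U_def V_def algebra_simps)
  qed
  ultimately show ?case by blast
qed

section \<open>Ideals stable under the Askey-Wilson operator\<close>

abbreviation symm :: "'a::field \<Rightarrow> 'a" where
  "symm z \<equiv> z + inverse z"

text \<open>Q stands for q^2, whose order is d'. The bound \<open>n3\<close> encodes that d is not
  1, 2 or 4; it yields Q^2 \<noteq> 1, hence that 1 + Q and Q - 1 are invertible.\<close>

locale primitive_root =
  fixes Q :: "'a::field" and n :: nat
  assumes closed: "alg_closed_field TYPE('a)"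
    and n3: "3 \<le> n"
    and Qn: "Q ^ n = 1"
    and Qk: "\<And>k. 0 < k \<Longrightarrow> k < n \<Longrightarrow> Q ^ k \<noteq> 1"
begin

section \<open>Powers of Q and the substitution X = z + 1/z\<close>

lemma Q_nonzero [simp]: "Q \<noteq> 0"
  using Qn n3 by (metis power_0_left not_numeral_le_zero zero_neq_one)

lemma Q_plus_1_nonzero: "1 + Q \<noteq> 0"
proof
  assume "1 + Q = 0"
  moreover have "Q ^ 2 - 1 = (1 + Q) * (Q - 1)" by (simp add: algebra_simps power2_eq_square)
  ultimately have "Q ^ 2 = 1" by simp
  then show False using Qk[of 2] n3 by simp
qed

lemma Q_neq_1: "Q \<noteq> 1"
  using Qk[of 1] n3 by simp

lemma Q_power_inj:
  assumes "Q ^ i = Q ^ j" "i < n" "j < n"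
  shows "i = j"
proof -
  have "i = j" if "i \<le> j" "j < n" "Q ^ i = Q ^ j" for i j
  proof (rule ccontr)
    assume "i \<noteq> j"
    have "Q ^ j = Q ^ i * Q ^ (j - i)" using that by (metis le_add_diff_inverse power_add)
    with that have "Q ^ (j - i) = 1" by simp
    then show False using Qk[of "j - i"] that \<open>i \<noteq> j\<close> by simp
  qed
  then show ?thesis using assms by (metis nat_le_linear)
qed

text \<open>Two monic polynomials of degree n that agree at the n distinct points c Q^k. In
  particular z^n - c^n has simple roots, whatever the characteristic.\<close>

lemma prod_power_root:
  assumes "c \<noteq> 0"
  shows "(\<Prod>k<n. [:- (c * Q ^ k), 1:]) = monom 1 n - [:c ^ n:]"
proof (rule poly_eqI_degree_lead_coeff[where A = "(\<lambda>k. c * Q ^ k) ` {..<n}" and n = n])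
  have inj: "inj_on (\<lambda>k. c * Q ^ k) {..<n}"
    using Q_power_inj assms by (auto intro!: inj_onI)
  show "n \<le> card ((\<lambda>k. c * Q ^ k) ` {..<n})" using card_image[OF inj] by simp
  show deg: "degree (\<Prod>k<n. [:- (c * Q ^ k), 1:]) \<le> n"
    using degree_prod_sum_le[of "{..<n}" "\<lambda>k. [:- (c * Q ^ k), 1:]"] by simp
  show "degree (monom 1 n - [:c ^ n:]) \<le> n"
    by (intro degree_diff_le) (auto simp: degree_monom_eq)
  have "degree (\<Prod>k<n. [:- (c * Q ^ k), 1:]) = n" by (simp add: degree_prod_eq_sum_degree)
  moreover have "lead_coeff (\<Prod>k<n. [:- (c * Q ^ k), 1:]) = 1" by (simp add: lead_coeff_prod)
  ultimately show "coeff (\<Prod>k<n. [:- (c * Q ^ k), 1:]) n = coeff (monom 1 n - [:c ^ n:]) n"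
    using n3 by (simp add: coeff_pCons split: nat.split)
  fix z assume "z \<in> (\<lambda>k. c * Q ^ k) ` {..<n}"
  then obtain k where k: "k < n" "z = c * Q ^ k" by auto
  have "z ^ n = c ^ n"
    using Qn by (simp add: k(2) power_mult_distrib power_mult[symmetric] mult.commute[of k])
       (simp add: power_mult)
  moreover have "(\<Prod>i<n. z - c * Q ^ i) = 0" using k by (intro prod_zero) auto
  ultimately show "poly (\<Prod>k<n. [:- (c * Q ^ k), 1:]) z = poly (monom 1 n - [:c ^ n:]) z"
    by (simp add: poly_prod poly_monom)
qed

lemma prod_power_root_eval:
  assumes "c \<noteq> 0"
  shows "(\<Prod>k<n. z - c * Q ^ k) = z ^ n - c ^ n"
  using arg_cong[OF prod_power_root[OF assms], of "\<lambda>f. poly f z"]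
  by (simp add: poly_prod poly_monom)

lemma power_eq_imp_Q_multiple:
  assumes "c \<noteq> 0" "y ^ n = c ^ n"
  obtains k where "k < n" "y = c * Q ^ k"
  using prod_power_root_eval[OF assms(1), of y] assms(2) by auto

lemma symm_eq_iff:
  assumes "z \<noteq> 0" "w \<noteq> 0"
  shows "symm z = symm w \<longleftrightarrow> z = w \<or> z * w = (1::'a)"
proof -
  have "symm z - symm w = (z - w) * (z * w - 1) / (z * w)"
    using assms by (simp add: field_simps)
  then show ?thesis using assms by (metis divide_eq_0_iff eq_iff_diff_eq_0 mult_eq_0_iff)
qed

lemma ex_symm:
  fixes y :: 'a
  obtains z where "z \<noteq> 0" "symm z = y"
proof -
  have "degree [:1, - y, 1:] \<noteq> 0" by simp
  then obtain z where "poly [:1, - y, 1:] z = 0"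
    using closed unfolding alg_closed_field_def by blast
  then have z: "1 + z * z - z * y = 0" by (simp add: algebra_simps)
  then have "z \<noteq> 0" by auto
  moreover have "symm z - y = inverse z * (1 + z * z - z * y)"
    using \<open>z \<noteq> 0\<close> by (simp add: field_simps)
  ultimately show thesis using z that by simp
qed

text \<open>Closed under z -> 1/z, and cofinite, so that values at these points determine
  polynomials in z and in z + 1/z.\<close>

definition regular :: "'a \<Rightarrow> bool" where
  "regular z \<longleftrightarrow> z \<noteq> 0 \<and> z\<^sup>2 \<noteq> 1 \<and> Q * z\<^sup>2 \<noteq> 1 \<and> z\<^sup>2 \<noteq> Q"

lemma infinite_regular: "infinite {z. regular z}"
proof -
  define f where "f = [:0, 1:] * [:-1, 0, 1:] * [:-1, 0, Q:] * [:- Q, 0, 1:]"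
  have "f \<noteq> 0" by (simp add: f_def)
  then have fin: "finite {z. poly f z = 0}" by (rule poly_roots_finite)
  have "poly f z = z * (z\<^sup>2 - 1) * (Q * z\<^sup>2 - 1) * (z\<^sup>2 - Q)" for z
    unfolding f_def poly_mult by (simp add: power2_eq_square mult_ac)
  then have "{z. \<not> regular z} \<subseteq> {z. poly f z = 0}"
    by (auto simp: regular_def)
  then have "finite {z. \<not> regular z}" using fin by (rule finite_subset)
  then show ?thesis
    using alg_closed_infinite[OF closed] finite_Collect_not by blast
qed

lemma regular_symm_infinite: "infinite (symm ` {z. regular z})"
proof
  assume fin: "finite (symm ` {z. regular z})"
  have "finite {z. regular z \<and> symm z = y}" for y
  proof -
    have "{z. regular z \<and> symm z = y} \<subseteq> {z. poly [:1, - y, 1:] z = 0}"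
    proof safe
      fix z assume "regular z" "y = symm z"
      then have "z \<noteq> 0" by (simp add: regular_def)
      then show "poly [:1, - symm z, 1:] z = 0" by (simp add: algebra_simps)
    qed
    then show ?thesis using finite_subset poly_roots_finite[of "[:1, - y, 1:]"] by auto
  qed
  then have "finite (\<Union>y\<in>symm ` {z. regular z}. {z. regular z \<and> symm z = y})"
    using fin by blast
  moreover have "{z. regular z} \<subseteq> (\<Union>y\<in>symm ` {z. regular z}. {z. regular z \<and> symm z = y})"
    by blast
  ultimately show False using infinite_regular finite_subset by blast
qed

lemma poly_eqI_symm:
  assumes "\<And>z. regular z \<Longrightarrow> poly f (symm z) = poly g (symm z)"
  shows "f = g"
  using regular_symm_infinite by (rule poly_eqI_infinite) (use assms in auto)

text \<open>The Askey-Wilson operator is encoded as a relation between polynomials, tested at the points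
  \<open>z\<close> at which neither of its two terms has a pole.\<close>

definition aw_term :: "(nat \<Rightarrow> 'a) \<Rightarrow> 'a poly \<Rightarrow> 'a \<Rightarrow> 'a" where
  "aw_term x f z = (\<Prod>i<4. 1 - x i * z) / ((1 - z\<^sup>2) * (1 - Q * z\<^sup>2))
     * (poly f (symm (Q * z)) - poly f (symm z))"

text \<open>That the right-hand side is a polynomial in z + 1/z is only learned later, from the
  Newton basis (\<open>aw_total\<close>). Constants are eigenvectors for \<mu> + 1/\<mu>, which for
  \<mu> = b / lam is \<open>theta q b lam 0\<close>.\<close>

definition aw :: "(nat \<Rightarrow> 'a) \<Rightarrow> 'a \<Rightarrow> 'a poly \<Rightarrow> 'a poly \<Rightarrow> bool" where
  "aw x \<mu> f g \<longleftrightarrow> (\<forall>z. regular z \<longrightarrow>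
     poly g (symm z) = (aw_term x f z + aw_term x f (inverse z)) / \<mu> + (\<mu> + inverse \<mu>) * poly f (symm z))"

definition aw_stable :: "(nat \<Rightarrow> 'a) \<Rightarrow> 'a \<Rightarrow> 'a poly \<Rightarrow> bool" where
  "aw_stable x \<mu> g \<longleftrightarrow> (\<forall>f f'. g dvd f \<and> aw x \<mu> f f' \<longrightarrow> g dvd f')"

lemma aw_unique: "aw x \<mu> f g \<Longrightarrow> aw x \<mu> f h \<Longrightarrow> g = h"
  by (rule poly_eqI_symm) (simp add: aw_def)

text \<open>Stability is used for \<open>B g = g h\<^sub>1\<close> and \<open>B (X g) = g h\<^sub>2\<close> only. Both are sums of a term at \<open>z\<close> and
  one at \<open>1/z\<close>; eliminating the latter between \<open>B g\<close> and the commutator \<open>B X - X B\<close> applied to \<open>g\<close>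
  isolates the term at \<open>z\<close>.\<close>

lemma aw_split:
  fixes x0 x1 x2 x3 \<mu> G Gq Gw h1 h2 z :: 'a
  defines "w \<equiv> inverse z"
  defines "A \<equiv> (1 - x0 * z) * (1 - x1 * z) * (1 - x2 * z) * (1 - x3 * z) / ((1 - z\<^sup>2) * (1 - Q * z\<^sup>2))"
    and "B \<equiv> (1 - x0 * w) * (1 - x1 * w) * (1 - x2 * w) * (1 - x3 * w) / ((1 - w\<^sup>2) * (1 - Q * w\<^sup>2))"
    and "K \<equiv> (1 - x0 * x1 * x2 * x3) * (1 + z\<^sup>2)
      - (x0 + x1 + x2 + x3 - (x0 * x1 * x2 + x0 * x1 * x3 + x0 * x2 * x3 + x1 * x2 * x3)) * z"
  assumes z: "regular z" and \<mu>: "\<mu> \<noteq> 0"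
    and H1: "G * h1 = (A * (Gq - G) + B * (Gw - G)) / \<mu> + (\<mu> + inverse \<mu>) * G"
    and H2: "G * h2 = (A * (symm (Q * z) * Gq - symm z * G) + B * (symm (Q * w) * Gw - symm z * G)) / \<mu>
      + (\<mu> + inverse \<mu>) * (symm z * G)"
  shows "(1 + Q) * (A * (1 - z\<^sup>2)) * (Gq - G)
    = G * (z * (- \<mu> * Q / (Q - 1) * (h2 - symm z * h1)) - K - (z\<^sup>2 - Q) * (\<mu> * h1 - \<mu>\<^sup>2 - 1))"
proof -
  have nz: "z \<noteq> 0" "1 - z\<^sup>2 \<noteq> 0" "1 - Q * z\<^sup>2 \<noteq> 0" "z\<^sup>2 - 1 \<noteq> 0" "z\<^sup>2 - Q \<noteq> 0" "Q - 1 \<noteq> 0"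
    using z Q_neq_1 by (auto simp: regular_def)
  have w: "1 - w\<^sup>2 = (z\<^sup>2 - 1) / z\<^sup>2" "1 - Q * w\<^sup>2 = (z\<^sup>2 - Q) / z\<^sup>2"
    using nz by (auto simp: w_def field_simps)
  have clear: "\<mu> * (S / \<mu> + (\<mu> + inverse \<mu>) * T) = S + (\<mu>\<^sup>2 + 1) * T" for S T
    using \<mu> by (simp add: field_simps power2_eq_square)
  have h1: "\<mu> * (G * h1) = A * (Gq - G) + B * (Gw - G) + (\<mu>\<^sup>2 + 1) * G"
    unfolding H1 clear ..
  then have S1: "A * (Gq - G) + B * (Gw - G) = G * (\<mu> * h1 - \<mu>\<^sup>2 - 1)"
    by (simp add: algebra_simps)
  have "\<mu> * (G * h2) = A * (symm (Q * z) * Gq - symm z * G) + B * (symm (Q * w) * Gw - symm z * G)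
      + (\<mu>\<^sup>2 + 1) * (symm z * G)"
    unfolding H2 clear ..
  moreover have "symm z * (\<mu> * (G * h1)) = symm z * (A * (Gq - G) + B * (Gw - G)) + (\<mu>\<^sup>2 + 1) * (symm z * G)"
    unfolding h1 by (simp only: distrib_left mult.left_commute)
  \<comment> \<open>Subtracting X times the first relation from the second removes every multiple of
    G on the right; only the shifted values survive, with coefficients Y - X and W - X.\<close>
  moreover have "A * (Y - X) * Gq + B * (W - X) * Gw = \<mu> * G * (h2 - X * h1)"
    if "\<mu> * (G * h2) = A * (Y * Gq - X * G) + B * (W * Gw - X * G) + k * (X * G)"
      "X * (\<mu> * (G * h1)) = X * (A * (Gq - G) + B * (Gw - G)) + k * (X * G)" for X Y W k
  proof -
    have "\<mu> * G * (h2 - X * h1) = \<mu> * (G * h2) - X * (\<mu> * (G * h1))" by (simp add: algebra_simps)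
    then show ?thesis unfolding that by (simp add: algebra_simps)
  qed
  ultimately have "A * (symm (Q * z) - symm z) * Gq + B * (symm (Q * w) - symm z) * Gw
      = \<mu> * G * (h2 - symm z * h1)"
    by blast
  moreover have eq1: "symm (Q * z) - symm z = - (Q - 1) / Q * ((1 - Q * z\<^sup>2) / z)"
    using nz by (simp add: field_simps power2_eq_square)
  moreover have eq2: "symm (Q * w) - symm z = - (Q - 1) / Q * ((z\<^sup>2 - Q) / z)"
    using nz by (simp add: w_def field_simps power2_eq_square)
  ultimately have e: "- (Q - 1) / Q * (A * ((1 - Q * z\<^sup>2) / z) * Gq + B * ((z\<^sup>2 - Q) / z) * Gw)
      = \<mu> * G * (h2 - symm z * h1)"
    unfolding eq1 eq2 by (simp only: distrib_left mult_ac)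
  have S2: "A * ((1 - Q * z\<^sup>2) / z) * Gq + B * ((z\<^sup>2 - Q) / z) * Gw
      = G * (- \<mu> * Q / (Q - 1) * (h2 - symm z * h1))" (is "?l = _")
  proof -
    have one: "- Q / (Q - 1) * (- (Q - 1) / Q) = 1" using nz by (simp add: field_simps)
    have "?l = - Q / (Q - 1) * (- (Q - 1) / Q * ?l)"
      unfolding mult.assoc[symmetric, of "- Q / (Q - 1)"] one by simp
    then show ?thesis unfolding e by (simp add: mult_ac)
  qed
  \<comment> \<open>Over the common denominator 1 - z^2 the numerator is N(z) - z^4 N(1/z), where N
    is the product of the 1 - x_i z. It is divisible by 1 - z^2, so the poles cancel.\<close>
  have K: "A * (1 - Q * z\<^sup>2) + B * (z\<^sup>2 - Q) = K"
  proof -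
    have "A * (1 - Q * z\<^sup>2) = (1 - x0 * z) * (1 - x1 * z) * (1 - x2 * z) * (1 - x3 * z) / (1 - z\<^sup>2)"
      using nz by (simp add: A_def)
    moreover have "B * (z\<^sup>2 - Q) = - ((z - x0) * (z - x1) * (z - x2) * (z - x3) / (1 - z\<^sup>2))"
    proof -
      have zx: "z * (1 - y * w) = z - y" for y using nz by (simp add: w_def field_simps)
      have "B * (z\<^sup>2 - Q) = z\<^sup>2 * z\<^sup>2 * ((1 - x0 * w) * (1 - x1 * w) * (1 - x2 * w) * (1 - x3 * w)) / (z\<^sup>2 - 1)"
        using nz unfolding B_def w by simp
      also have "z\<^sup>2 * z\<^sup>2 * ((1 - x0 * w) * (1 - x1 * w) * (1 - x2 * w) * (1 - x3 * w))
          = (z * (1 - x0 * w)) * (z * (1 - x1 * w)) * (z * (1 - x2 * w)) * (z * (1 - x3 * w))"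
        by (simp add: power2_eq_square mult_ac)
      also have "\<dots> = (z - x0) * (z - x1) * (z - x2) * (z - x3)"
        unfolding zx ..
      also have "z\<^sup>2 - 1 = - (1 - z\<^sup>2)" by simp
      finally show ?thesis by (simp only: divide_minus_right)
    qed
    moreover have "(1 - x0 * z) * (1 - x1 * z) * (1 - x2 * z) * (1 - x3 * z)
        - (z - x0) * (z - x1) * (z - x2) * (z - x3) = K * (1 - z\<^sup>2)"
      unfolding K_def by (simp add: algebra_simps power2_eq_square)
    ultimately have "A * (1 - Q * z\<^sup>2) + B * (z\<^sup>2 - Q) = K * (1 - z\<^sup>2) / (1 - z\<^sup>2)"
      by (metis diff_conv_add_uminus diff_divide_distrib)
    then show ?thesis using nz by simp
  qed
  have "A * (1 - Q * z\<^sup>2) * Gq + B * (z\<^sup>2 - Q) * Gw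
      = z * (A * ((1 - Q * z\<^sup>2) / z) * Gq + B * ((z\<^sup>2 - Q) / z) * Gw)"
    using nz by (simp add: field_simps)
  then have "A * (1 - Q * z\<^sup>2) * Gq + B * (z\<^sup>2 - Q) * Gw
      = G * (z * (- \<mu> * Q / (Q - 1) * (h2 - symm z * h1)))" unfolding S2 by (simp add: mult_ac)
  then have D1: "A * (1 - Q * z\<^sup>2) * (Gq - G) + B * (z\<^sup>2 - Q) * (Gw - G)
      = G * (z * (- \<mu> * Q / (Q - 1) * (h2 - symm z * h1)) - K)"
    unfolding K[symmetric] by (simp add: algebra_simps)
  \<comment> \<open>The coefficient of B is eliminated. What remains at A is (1 - Q z^2) - (z^2 - Q)
    = (1 + Q) (1 - z^2), the origin of the factor 1 + Q.\<close>
  have D2: "(1 + Q) * (A * (1 - z\<^sup>2)) * (Gq - G)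
      = (A * (1 - Q * z\<^sup>2) * (Gq - G) + B * (z\<^sup>2 - Q) * (Gw - G))
        - (z\<^sup>2 - Q) * (A * (Gq - G) + B * (Gw - G))"
    by (simp add: algebra_simps)
  show ?thesis
    unfolding D2 D1 S1 by (simp only: right_diff_distrib mult_ac)
qed

lemma poly_symm_Q_inverse:
  assumes "z \<noteq> 0"
  shows "symm (Q * inverse (Q * z)) = symm z"
    and "symm (inverse (Q * z)) = symm (Q * z)"
    and "symm (inverse z) = symm (z::'a)"
proof -
  have eq: "Q * inverse (Q * z) = inverse z" using assms by simp
  show "symm (Q * inverse (Q * z)) = symm z" unfolding eq inverse_inverse_eq by (rule add.commute)
qed (simp_all add: add.commute)

lemma aw_stableD: "aw_stable x \<mu> g \<Longrightarrow> g dvd f \<Longrightarrow> aw x \<mu> f f' \<Longrightarrow> g dvd f'"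
  unfolding aw_stable_def by blast

text \<open>\<open>aw_split\<close> multiplied by z^(m + d + 1) is an identity of polynomials in
  which F divides the right-hand side. The extra power of z is coprime to F because F(0) \<noteq> 0,
  and 1 + Q is a unit.\<close>

lemma aw_stable_hat_dvd:
  assumes stable: "aw_stable x \<mu> g" and \<mu>: "\<mu> \<noteq> 0"
    and total: "\<And>f. \<exists>f'. aw x \<mu> f f'"
    and F: "\<And>z. z \<noteq> 0 \<Longrightarrow> poly F z = z ^ m * poly g (symm z)"
    and F0: "poly F 0 \<noteq> 0"
    and r: "\<And>z. z \<noteq> 0 \<Longrightarrow> (Q * z\<^sup>2 - 1) * poly r z
           = z ^ m * (poly g (symm (Q * z)) - poly g (symm z))"
  shows "F dvd (\<Prod>i<4. [:1, - x i:]) * r"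
proof -
  obtain f1 where f1: "aw x \<mu> g f1" using total by blast
  obtain f2 where f2: "aw x \<mu> ([:0, 1:] * g) f2" using total by blast
  have "g dvd f1" using aw_stableD[OF stable dvd_refl f1] .
  then obtain h1 where h1: "f1 = g * h1" by (elim dvdE)
  have "g dvd f2" using aw_stableD[OF stable dvd_triv_right f2] .
  then obtain h2 where h2: "f2 = g * h2" by (elim dvdE)
  define d where "d = max (degree h1) (degree h2)"
  obtain H1 where H1: "\<And>z. z \<noteq> 0 \<Longrightarrow> poly H1 z = z ^ d * poly h1 (symm z)"
    using hat_poly_exists[of h1 d 1] by (auto simp: d_def)
  obtain H2 where H2: "\<And>z. z \<noteq> 0 \<Longrightarrow> poly H2 z = z ^ d * poly h2 (symm z)"
    using hat_poly_exists[of h2 d 1] by (auto simp: d_def)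
  define e where "e = x 0 + x 1 + x 2 + x 3
    - (x 0 * x 1 * x 2 + x 0 * x 1 * x 3 + x 0 * x 2 * x 3 + x 1 * x 2 * x 3)"
  \<comment> \<open>T is z^(d + 1) times the cofactor of G in \<open>aw_split\<close>, with H1 and
    H2 in place of the cofactors h1 and h2.\<close>
  define T where "T = smult (- \<mu> * Q / (Q - 1)) ([:0, 0, 1:] * H2 - [:0, 1:] * [:1, 0, 1:] * H1)
     - [:0, 1:] ^ (d + 1) * (smult (1 - x 0 * x 1 * x 2 * x 3) [:1, 0, 1:] - smult e [:0, 1:])
     - [:0, 1:] * [:- Q, 0, 1:] * (smult \<mu> H1 - smult (\<mu>\<^sup>2 + 1) ([:0, 1:] ^ d))"
  have "smult (- (1 + Q)) ([:0, 1:] ^ (d + 1) * ((\<Prod>i<4. [:1, - x i:]) * r)) = F * T"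
  proof (rule poly_eqI_infinite[OF infinite_regular])
    fix z assume "z \<in> {z. regular z}"
    then have z: "regular z" by simp
    then have nz: "z \<noteq> 0" "1 - Q * z\<^sup>2 \<noteq> 0" "1 - z\<^sup>2 \<noteq> 0" by (auto simp: regular_def)
    let ?A = "(1 - x 0 * z) * (1 - x 1 * z) * (1 - x 2 * z) * (1 - x 3 * z) / ((1 - z\<^sup>2) * (1 - Q * z\<^sup>2))"
    let ?G = "poly g (symm z)" and ?Gq = "poly g (symm (Q * z))"
    let ?s = "z * (- \<mu> * Q / (Q - 1) * (poly h2 (symm z) - symm z * poly h1 (symm z)))
      - ((1 - x 0 * x 1 * x 2 * x 3) * (1 + z\<^sup>2) - e * z)
      - (z\<^sup>2 - Q) * (\<mu> * poly h1 (symm z) - \<mu>\<^sup>2 - 1)"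
    have p4: "(\<Prod>i<4. t i) = t 0 * t 1 * t 2 * t 3" for t :: "nat \<Rightarrow> 'a"
      by (simp add: eval_nat_numeral mult_ac)
    have "(1 + Q) * (?A * (1 - z\<^sup>2)) * (?Gq - ?G) = ?G * ?s"
      unfolding e_def
    proof (rule aw_split[OF z \<mu>])
      show "?G * poly h1 (symm z) = (?A * (?Gq - ?G)
          + (1 - x 0 * inverse z) * (1 - x 1 * inverse z) * (1 - x 2 * inverse z) * (1 - x 3 * inverse z)
            / ((1 - (inverse z)\<^sup>2) * (1 - Q * (inverse z)\<^sup>2)) * (poly g (symm (Q * inverse z)) - ?G)) / \<mu>
          + (\<mu> + inverse \<mu>) * ?G"
        using f1[unfolded aw_def, rule_format, OF z]
        unfolding aw_term_def h1 p4 poly_mult poly_symm_Q_inverse(3)[OF nz(1)] .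
      have pX: "poly ([:0, 1:] * g) y = y * poly g y" for y by simp
      show "?G * poly h2 (symm z) = (?A * (symm (Q * z) * ?Gq - symm z * ?G)
          + (1 - x 0 * inverse z) * (1 - x 1 * inverse z) * (1 - x 2 * inverse z) * (1 - x 3 * inverse z)
            / ((1 - (inverse z)\<^sup>2) * (1 - Q * (inverse z)\<^sup>2))
            * (symm (Q * inverse z) * poly g (symm (Q * inverse z)) - symm z * ?G)) / \<mu>
          + (\<mu> + inverse \<mu>) * (symm z * ?G)"
        using f2[unfolded aw_def, rule_format, OF z]
        unfolding aw_term_def h2 pX p4 poly_symm_Q_inverse(3)[OF nz(1)] poly_mult[of g] .
    qed
    moreover have A: "?A * (1 - z\<^sup>2) = (\<Prod>i<4. 1 - x i * z) / (1 - Q * z\<^sup>2)"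
      using nz by (simp add: p4)
    ultimately have e: "(1 + Q) * ((\<Prod>i<4. 1 - x i * z) / (1 - Q * z\<^sup>2)) * (?Gq - ?G) = ?G * ?s"
      by (simp only:)
    have "(1 + Q) * ((\<Prod>i<4. 1 - x i * z) / (1 - Q * z\<^sup>2)) * (z ^ m * (?Gq - ?G)) = z ^ m * (?G * ?s)"
      by (subst mult.left_commute) (simp only: e)
    moreover have "z ^ m * (?Gq - ?G) = - (1 - Q * z\<^sup>2) * poly r z"
      using r[OF nz(1)] by simp
    moreover have "(1 + Q) * ((\<Prod>i<4. 1 - x i * z) / (1 - Q * z\<^sup>2)) * (- (1 - Q * z\<^sup>2) * poly r z)
        = - (1 + Q) * ((\<Prod>i<4. 1 - x i * z) * poly r z)"
    proof -
      have "(1 + Q) * (N / D) * (- D * R) = - (1 + Q) * (N * R)" if "D \<noteq> 0" for N D R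
        using that by (simp add: field_simps)
      then show ?thesis using nz(2) .
    qed
    ultimately have "- (1 + Q) * ((\<Prod>i<4. 1 - x i * z) * poly r z) = z ^ m * (?G * ?s)"
      by (simp only:)
    then have R: "z ^ (d + 1) * (- (1 + Q) * ((\<Prod>i<4. 1 - x i * z) * poly r z)) = poly F z * (z ^ (d + 1) * ?s)"
      unfolding F[OF nz(1)] by (simp only: mult_ac)
    have T: "z ^ (d + 1) * ?s = poly T z"
    proof -
      have zs: "z * symm z = 1 + z\<^sup>2" using nz by (simp add: algebra_simps power2_eq_square)
      have "poly T z = - \<mu> * Q / (Q - 1) * (z\<^sup>2 * poly H2 z - z * (1 + z\<^sup>2) * poly H1 z)
        - z ^ (d + 1) * ((1 - x 0 * x 1 * x 2 * x 3) * (1 + z\<^sup>2) - e * z)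
        - z * (z\<^sup>2 - Q) * (\<mu> * poly H1 z - (\<mu>\<^sup>2 + 1) * z ^ d)"
      proof -
        have "poly [:0, 1:] z = z" "poly [:1, 0, 1:] z = 1 + z\<^sup>2"
          "poly [:0, 0, 1:] z = z\<^sup>2" "poly [:- Q, 0, 1:] z = z\<^sup>2 - Q"
          by (simp_all add: power2_eq_square)
        then show ?thesis
          unfolding T_def poly_diff poly_mult poly_smult poly_power by (simp only:)
      qed
      also have "z\<^sup>2 * poly H2 z - z * (1 + z\<^sup>2) * poly H1 z
          = z ^ (d + 1) * (z * (poly h2 (symm z) - symm z * poly h1 (symm z)))"
        unfolding H1[OF nz(1)] H2[OF nz(1)] zs[symmetric]
        by (simp only: power_add power_one_right power2_eq_square right_diff_distrib mult_ac)
      also have "\<mu> * poly H1 z - (\<mu>\<^sup>2 + 1) * z ^ d = z ^ d * (\<mu> * poly h1 (symm z) - \<mu>\<^sup>2 - 1)"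
        unfolding H1[OF nz(1)] by (simp add: algebra_simps)
      finally show ?thesis
        by (simp only: power_add power_one_right right_diff_distrib mult_ac)
    qed
    have "poly (\<Prod>i<4. [:1, - x i:]) z = (\<Prod>i<4. 1 - x i * z)" "poly [:0, 1:] z = z"
      by (simp_all add: poly_prod mult.commute)
    then show "poly (smult (- (1 + Q)) ([:0, 1:] ^ (d + 1) * ((\<Prod>i<4. [:1, - x i:]) * r))) z = poly (F * T) z"
      unfolding poly_smult poly_mult poly_power T[symmetric] R[symmetric]
      by (simp only: mult.left_commute)
  qed
  then have "F dvd smult (- (1 + Q)) ([:0, 1:] ^ (d + 1) * ((\<Prod>i<4. [:1, - x i:]) * r))"
    by simp
  moreover have "- (1 + Q) \<noteq> 0" using Q_plus_1_nonzero unfolding neg_equal_0_iff_equal .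
  ultimately have "F dvd [:0, 1:] ^ (d + 1) * ((\<Prod>i<4. [:1, - x i:]) * r)"
    using dvd_smult_cancel by blast
  then show ?thesis by (rule dvd_power_X_mult_cancel[OF F0])
qed

section \<open>From a stable factor to a pair of parameters\<close>

lemma symm_power_eq_iff:
  assumes "z \<noteq> 0" "s \<noteq> 0"
  shows "z ^ n + inverse z ^ n = symm s \<longleftrightarrow> z ^ n = s \<or> z ^ n * s = (1::'a)"
  using symm_eq_iff[of "z ^ n" s] assms by (simp add: power_inverse)

text \<open>If every step from z to Q z stayed among the roots, g would vanish at the n values
  \<open>symm (z * Q ^ k)\<close>. Two of these could coincide for different k only if z Q^i and z
  Q^j were inverse, and n-th powers would then give t^2 = 1.\<close>

lemma ex_orbit_descent:
  assumes deg: "0 < degree g" "degree g < n"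
    and roots: "\<And>z. z \<noteq> 0 \<Longrightarrow> poly g (symm z) = 0 \<Longrightarrow> z ^ n + inverse z ^ n = symm t"
    and t: "t \<noteq> 0" "t * t \<noteq> 1"
  obtains z where "z \<noteq> 0" "z ^ n = t" "poly g (symm z) = 0" "poly g (symm (Q * z)) \<noteq> 0"
proof -
  obtain y where y: "poly g y = 0"
    using closed deg(1) unfolding alg_closed_field_def by blast
  obtain w where w: "w \<noteq> 0" "symm w = y" by (rule ex_symm)
  have "w ^ n + inverse w ^ n = symm t" using roots w y by simp
  then consider "w ^ n = t" | "w ^ n * t = 1" unfolding symm_power_eq_iff[OF w(1) t(1)] by blast
  then obtain z where z: "z \<noteq> 0" "z ^ n = t" "symm z = y"
  proof cases
    case 1
    then show ?thesis using that w by blast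
  next
    case 2
    then have "inverse w ^ n = t" by (simp add: power_inverse inverse_unique)
    moreover have "symm (inverse w) = y" using w by (simp add: add.commute)
    ultimately show ?thesis using that[of "inverse w"] w by simp
  qed
  have pow: "(z * Q ^ k) ^ n = t" for k
    using z(2) Qn by (simp add: power_mult_distrib power_mult[symmetric] mult.commute[of k])
       (simp add: power_mult)
  have "\<exists>k. poly g (symm (z * Q ^ k)) = 0 \<and> poly g (symm (z * Q ^ Suc k)) \<noteq> 0"
  proof (rule ccontr)
    assume neg: "\<not> ?thesis"
    have all0: "poly g (symm (z * Q ^ k)) = 0" for k
      by (induction k) (use y z neg in auto)
    have "inj_on (\<lambda>k. symm (z * Q ^ k)) {..<n}"
    proof (rule inj_onI)
      fix i j assume ij: "i \<in> {..<n}" "j \<in> {..<n}" "symm (z * Q ^ i) = symm (z * Q ^ j)"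
      have "z * Q ^ i * (z * Q ^ j) \<noteq> 1"
      proof
        assume "z * Q ^ i * (z * Q ^ j) = 1"
        then have "(z * Q ^ i * (z * Q ^ j)) ^ n = 1" by simp
        then have "t * t = 1" unfolding power_mult_distrib[of "z * Q ^ i"] pow .
        then show False using t by simp
      qed
      then have "z * Q ^ i = z * Q ^ j"
        using ij symm_eq_iff[of "z * Q ^ i" "z * Q ^ j"] z(1) by simp
      then show "i = j" using z(1) ij Q_power_inj by simp
    qed
    then have "n = card ((\<lambda>k. symm (z * Q ^ k)) ` {..<n})" by (simp add: card_image)
    also have "\<dots> \<le> card {u. poly g u = 0}"
      using deg all0 by (intro card_mono poly_roots_finite) auto
    also have "\<dots> \<le> degree g" using deg by (intro card_poly_roots_bound) auto
    finally show False using deg by simp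
  qed
  then obtain k where "poly g (symm (z * Q ^ k)) = 0" "poly g (symm (Q * (z * Q ^ k))) \<noteq> 0"
    by (auto simp: mult_ac)
  then show thesis using that[of "z * Q ^ k"] pow z(1) by simp
qed

text \<open>c is a simple root of z^n - c^n, hence of multiplicity exactly two in the
  square.\<close>

lemma triple_root_not_dvd:
  fixes c :: 'a
  assumes "c \<noteq> 0"
  shows "\<not> [:- c, 1:] ^ 3 dvd (monom 1 n - [:c ^ n:]) ^ 2"
proof
  assume dvd: "[:- c, 1:] ^ 3 dvd (monom 1 n - [:c ^ n:]) ^ 2"
  define h where "h = (\<Prod>k\<in>{1..<n}. [:- (c * Q ^ k), 1:])"
  have "{..<n} = insert 0 {1..<n}" using n3 by auto
  then have eq: "monom 1 n - [:c ^ n:] = [:- c, 1:] * h"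
    unfolding prod_power_root[OF assms, symmetric] h_def by simp
  have "[:- c, 1:] ^ 3 = [:- c, 1:] ^ 2 * [:- c, 1:]" by (simp only: power3_eq_cube power2_eq_square)
  then have "[:- c, 1:] ^ 2 * [:- c, 1:] dvd [:- c, 1:] ^ 2 * h ^ 2"
    using dvd unfolding eq power_mult_distrib by (simp only:)
  then have "[:- c, 1:] dvd h ^ 2"
    by (subst (asm) dvd_mult_cancel_left) simp
  then have "poly h c = 0" by (simp add: poly_eq_0_iff_dvd[symmetric])
  then have "(\<Prod>k\<in>{1..<n}. c - c * Q ^ k) = 0" by (simp add: h_def poly_prod)
  then obtain k where "k \<in> {1..<n}" "c - c * Q ^ k = 0" by auto
  then show False using Qk[of k] assms by simp
qed

text \<open>The prefactor \<open>(1 - x z) (1 - y z) / (Q z\<^sup>2 - 1)\<close> changes sign under \<open>z \<mapsto> 1 / (Q z)\<close> when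
  \<open>x y = Q\<close>, and this substitution exchanges \<open>g(z + 1/z)\<close> and \<open>g(Q z + 1/(Q z))\<close>; compare the
  relation at both points.\<close>

lemma shift_invariant_of_relation:
  assumes rel: "\<And>z. z \<noteq> 0 \<Longrightarrow> v * poly g (symm z) * (Q * z\<^sup>2 - 1)
      = (1 - x * z) * (1 - y * z) * (poly g (symm (Q * z)) - poly g (symm z))"
    and xy: "x * y = Q" and z: "regular z" and v: "v \<noteq> 0"
  shows "poly g (symm (Q * z)) = poly g (symm z)"
proof -
  define w where "w = inverse (Q * z)"
  have nz: "z \<noteq> 0" "Q * z\<^sup>2 - 1 \<noteq> 0" using z by (auto simp: regular_def)
  have w: "w \<noteq> 0" "Q * z * w = 1" using nz by (simp_all add: w_def del: inverse_mult_distrib)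
  define G where "G = poly g (symm z)"
  define Gq where "Gq = poly g (symm (Q * z))"
  have G: "poly g (symm (Q * w)) = G" "poly g (symm w) = Gq"
    unfolding w_def G_def Gq_def poly_symm_Q_inverse[OF nz(1)] by (rule refl)+
  have 1: "v * G * (Q * z\<^sup>2 - 1) = (1 - x * z) * (1 - y * z) * (Gq - G)"
    using rel[OF nz(1)] by (simp add: G_def Gq_def)
  have 2: "v * Gq * (Q * w\<^sup>2 - 1) = (1 - x * w) * (1 - y * w) * (G - Gq)"
    using rel[OF w(1)] unfolding G .
  have "Q * z\<^sup>2 * (Q * w\<^sup>2 - 1) = (Q * z * w) ^ 2 - Q * z\<^sup>2"
    by (simp add: algebra_simps power2_eq_square)
  then have a: "Q * z\<^sup>2 * (Q * w\<^sup>2 - 1) = 1 - Q * z\<^sup>2" by (simp add: w)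
  have "Q * z\<^sup>2 * ((1 - x * w) * (1 - y * w))
     = Q * z\<^sup>2 - (x + y) * z * (Q * z * w) + x * y * z * w * (Q * z * w)"
    using xy by (simp add: algebra_simps power2_eq_square)
  also have "\<dots> = x * y * z\<^sup>2 - (x + y) * z + Q * z * w"
    by (simp add: w(2) xy)
  also have "\<dots> = (1 - x * z) * (1 - y * z)"
    unfolding w(2) by (simp add: algebra_simps power2_eq_square)
  finally have b: "Q * z\<^sup>2 * ((1 - x * w) * (1 - y * w)) = (1 - x * z) * (1 - y * z)" .
  have "v * Gq * (1 - Q * z\<^sup>2) = Q * z\<^sup>2 * (v * Gq * (Q * w\<^sup>2 - 1))"
    unfolding a[symmetric] by (simp only: mult_ac)
  also have "\<dots> = Q * z\<^sup>2 * ((1 - x * w) * (1 - y * w)) * (G - Gq)"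
    unfolding 2 by (simp only: mult_ac)
  also have "\<dots> = - (v * G * (Q * z\<^sup>2 - 1))" unfolding b 1 by (simp add: algebra_simps)
  finally have "v * (Q * z\<^sup>2 - 1) * Gq = v * (Q * z\<^sup>2 - 1) * G" by (simp add: algebra_simps)
  then show ?thesis using v nz(2) by (simp add: G_def Gq_def)
qed

text \<open>Write y = Q^j. For j = 0 take k = 0, otherwise k = n - j; the bound n - 2 fails only for
  j = 1.\<close>

lemma mult_Q_power_eq_1:
  assumes "(y::'a) ^ n = 1" "y \<noteq> Q"
  shows "\<exists>k\<le>n - 2. y * Q ^ k = 1"
proof -
  obtain k where k: "k < n" "y = Q ^ k"
    using power_eq_imp_Q_multiple[of 1 y] assms(1) by auto
  show ?thesis
  proof (cases "k = 0")
    case True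
    then show ?thesis using k by (intro exI[of _ 0]) simp
  next
    case False
    then have "k \<ge> 2" using k assms(2) by (cases "k = 1") auto
    moreover have "Q ^ k * Q ^ (n - k) = 1" using k Qn by (simp flip: power_add)
    ultimately show ?thesis using k by (intro exI[of _ "n - k"]) simp
  qed
qed

lemma aw_stable_imp_pair:
  assumes stable: "aw_stable x \<mu> g" and \<mu>: "\<mu> \<noteq> 0"
    and total: "\<And>f. \<exists>f'. aw x \<mu> f f'"
    and x: "\<And>i. i < 4 \<Longrightarrow> x i \<noteq> 0"
    and P: "\<And>z. z \<noteq> 0 \<Longrightarrow> poly P (symm z) = z ^ n + inverse z ^ n - \<kappa>"
    and g: "g dvd P" "0 < degree g" "degree g < n" and degP: "degree P = n"
  shows "\<exists>i<4. \<exists>j<4. i \<noteq> j \<and> x i ^ n + inverse (x i) ^ n = \<kappa> \<and> (\<exists>k\<le>n - 2. x i * x j * Q ^ k = 1)"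
proof -
  define m where "m = degree g"
  obtain F r where
    F: "\<And>z. z \<noteq> 0 \<Longrightarrow> poly F z = z ^ m * poly g (symm z)"
    and F0: "poly F 0 = coeff g m" and Fm: "coeff F (2 * m) = coeff g m" and dF: "degree F \<le> 2 * m"
    and r: "\<And>z. z \<noteq> 0 \<Longrightarrow> (Q * z\<^sup>2 - 1) * poly r z
           = z ^ m * (poly g (symm (Q * z)) - poly g (symm z))"
    using hat_poly_exists[of g m Q] by (auto simp: m_def)
  have lc: "coeff g m \<noteq> 0" using g by (auto simp: m_def)
  have F0': "poly F 0 \<noteq> 0" using F0 lc by simp
  have degF: "degree F = 2 * m" using dF Fm lc le_degree[of F "2 * m"] by simp
  have Fdvd: "F dvd (\<Prod>i<4. [:1, - x i:]) * r"
    by (rule aw_stable_hat_dvd[OF stable \<mu> total F F0' r])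
  \<comment> \<open>Evaluating F at Q z gives Q^m z^m g(Q z + 1/(Q z)), whence the factor
    Q^(-m).\<close>
  have shift: "[:-1, 0, Q:] * r = smult (inverse (Q ^ m)) (F \<circ>\<^sub>p [:0, Q:]) - F"
  proof (rule poly_eqI_infinite[OF infinite_regular])
    fix z assume "z \<in> {z. regular z}"
    then have z: "z \<noteq> 0" by (simp add: regular_def)
    have "poly ([:-1, 0, Q:] * r) z = (Q * z\<^sup>2 - 1) * poly r z"
      by (simp add: algebra_simps power2_eq_square)
    also have "\<dots> = inverse (Q ^ m) * poly F (Q * z) - poly F z"
      unfolding r[OF z] using z by (simp add: F power_mult_distrib right_diff_distrib)
    finally show "poly ([:-1, 0, Q:] * r) z = poly (smult (inverse (Q ^ m)) (F \<circ>\<^sub>p [:0, Q:]) - F) z"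
      by (simp add: poly_pcompose mult.commute)
  qed
  \<comment> \<open>Comparing constant terms, r(0) = (1 - Q^(-m)) F(0), and 0 < m < n. This is the
    nonvanishing of the q-difference that the case s^2 = 1 contradicts.\<close>
  have r0: "poly r 0 \<noteq> 0"
  proof
    assume "poly r 0 = 0"
    then have "inverse (Q ^ m) * poly F 0 - poly F 0 = 0"
      using arg_cong[OF shift, of "\<lambda>h. poly h 0"] by (simp add: poly_pcompose)
    then have "inverse (Q ^ m) = 1" using F0' by simp
    then show False using Qk[of m] g by (simp add: m_def)
  qed
  \<comment> \<open>The loss of two degrees against deg F = 2 m comes from the divisor Q z^2 - 1 and
    is the source of the two parameters.\<close>
  have degr: "degree r + 2 \<le> 2 * m"
  proof -
    have "degree (smult (inverse (Q ^ m)) (F \<circ>\<^sub>p [:0, Q:]) - F) \<le> 2 * m"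
      using degF by (intro degree_diff_le) (auto simp: degree_pcompose)
    moreover have "degree ([:-1, 0, Q:] * r) = 2 + degree r"
      using r0 by (subst degree_mult_eq) auto
    ultimately show ?thesis unfolding shift by simp
  qed
  obtain s where s: "s \<noteq> 0" "symm s = \<kappa>" by (rule ex_symm)
  have roots: "z ^ n + inverse z ^ n = \<kappa>" if "z \<noteq> 0" "poly g (symm z) = 0" for z
    using g(1) P[OF that(1)] that(2) by (auto elim!: dvdE)
  show ?thesis
  proof (cases "s * s = 1")
    case False
    \<comment> \<open>At the last root of a chain r does not vanish, so the zero of F there must be
      a zero of one of the factors 1 - x_i z.\<close>
    have descent: "\<exists>i<4. \<exists>z. z * x i = 1 \<and> z ^ n = t \<and> poly g (symm z) = 0 \<and> poly g (symm (Q * z)) \<noteq> 0"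
      if t: "t \<noteq> 0" "t * t \<noteq> 1" "symm t = \<kappa>" for t
    proof -
      obtain z where z: "z \<noteq> 0" "z ^ n = t" "poly g (symm z) = 0" "poly g (symm (Q * z)) \<noteq> 0"
        using ex_orbit_descent[OF g(2,3) _ t(1,2)] roots t(3) by metis
      have "poly r z \<noteq> 0" using r[OF z(1)] z by auto
      moreover obtain k where k: "(\<Prod>i<4. [:1, - x i:]) * r = F * k" using Fdvd by (elim dvdE)
      have "poly ((\<Prod>i<4. [:1, - x i:]) * r) z = 0" unfolding k using F z by simp
      ultimately have "(\<Prod>i<4. 1 - z * x i) = 0" by (simp add: poly_prod)
      then obtain i where "i < 4" "z * x i = 1" by auto
      then show ?thesis using z by blast
    qed
    have "inverse s * inverse s \<noteq> 1" using False s(1) by (metis inverse_1 inverse_inverse_eq inverse_mult_distrib)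
    moreover have "symm (inverse s) = \<kappa>" using s by (simp add: add.commute)
    ultimately obtain j w where w: "j < 4" "w * x j = 1" "w ^ n = inverse s"
      "poly g (symm w) = 0" "poly g (symm (Q * w)) \<noteq> 0"
      using descent[of "inverse s"] s(1) by auto
    obtain i z where z: "i < 4" "z * x i = 1" "z ^ n = s"
      "poly g (symm z) = 0" "poly g (symm (Q * z)) \<noteq> 0"
      using descent[of s] s False by auto
    have xi: "x i = inverse z" and xj: "x j = inverse w"
      using z(2) w(2) by (simp_all add: inverse_unique)
    have nz: "z \<noteq> 0" "w \<noteq> 0" using z w by auto
    have "s \<noteq> inverse s" using False s(1) by (metis right_inverse)
    then have "i \<noteq> j" using xi xj z(3) w(3) by auto
    moreover have "x i ^ n + inverse (x i) ^ n = \<kappa>"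
      using roots[OF nz(1) z(4)] by (simp add: xi add.commute)
    moreover have "(x i * x j) ^ n = 1"
      using s(1) by (simp add: xi xj power_mult_distrib power_inverse z(3) w(3))
    moreover have "x i * x j \<noteq> Q"
    proof
      assume "x i * x j = Q"
      then have "Q * z = inverse w" using nz by (simp add: xi xj field_simps)
      then have "symm (Q * z) = symm w" by (simp add: add.commute)
      then show False using z(5) w(4) by simp
    qed
    ultimately show ?thesis using mult_Q_power_eq_1[of "x i * x j"] z(1) w(1) by blast
  next
    case True
    have "\<exists>J w. J \<subseteq> {..<4} \<and> F = (\<Prod>i\<in>J. [:1, - x i:]) * w \<and> w dvd r"
      using Fdvd x by (intro dvd_prod_linear_mult_split) auto
    then obtain J w where J: "J \<subseteq> {..<4}" and Fw: "F = (\<Prod>i\<in>J. [:1, - x i:]) * w" and wr: "w dvd r"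
      by blast
    have finJ: "finite J" using J finite_subset by blast
    have r_nz: "r \<noteq> 0" using r0 by auto
    have "F \<noteq> 0" using F0' by auto
    then have w_nz: "w \<noteq> 0" using Fw by auto
    have "degree (\<Prod>i\<in>J. [:1, - x i:]) = card J"
      using J x by (subst degree_prod_eq_sum_degree) (auto simp: subset_iff)
    then have degFw: "2 * m = card J + degree w"
      using degF Fw w_nz finJ by (metis \<open>F \<noteq> 0\<close> degree_mult_eq mult_eq_0_iff)
    have "degree w \<le> degree r" using wr r_nz by (rule dvd_imp_degree_le)
    then have cardJ: "card J \<ge> 2" using degFw degr by simp
    have xs: "x i ^ n + inverse (x i) ^ n = \<kappa>" "x i ^ n = s" if "i \<in> J" for i
    proof -
      have xi: "x i \<noteq> 0" using that J x by auto
      have "[:1, - x i:] dvd F" unfolding Fw using that finJ by (intro dvd_mult2 dvd_prodI)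
      then have "poly F (inverse (x i)) = 0" unfolding linear_dvd_iff[OF xi] .
      then have "poly g (symm (inverse (x i))) = 0" using F[of "inverse (x i)"] xi by simp
      then show *: "x i ^ n + inverse (x i) ^ n = \<kappa>"
        using roots[of "inverse (x i)"] xi by (simp add: add.commute)
      then have "x i ^ n = s \<or> x i ^ n * s = 1"
        using symm_power_eq_iff[OF xi s(1)] s(2) by simp
      then show "x i ^ n = s" using True s(1) by (metis mult_right_cancel)
    qed
    show ?thesis
    proof (cases "\<exists>i\<in>J. \<exists>j\<in>J. i \<noteq> j \<and> x i * x j \<noteq> Q")
      case pair: True
      then obtain i j where ij: "i \<in> J" "j \<in> J" "i \<noteq> j" "x i * x j \<noteq> Q" by blast
      have "(x i * x j) ^ n = 1" using xs(2) ij True by (simp add: power_mult_distrib)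
      then show ?thesis using mult_Q_power_eq_1[of "x i * x j"] ij xs(1) J by blast
    next
      case False
      show ?thesis
      proof (cases "card J = 2")
        \<comment> \<open>Equality holds in the degree count: deg w = 2 m - 2 \<ge> deg r, so r is a
          constant multiple of w and the divisibility becomes an exact relation.\<close>
        case c2: True
        then obtain i j where ij: "J = {i, j}" "i \<noteq> j" by (auto simp: card_2_iff)
        have xy: "x i * x j = Q" using False ij by blast
        obtain v where v: "r = w * v" using wr by (elim dvdE)
        have "degree v = 0"
          using degFw c2 degr r_nz unfolding v by (subst (asm) degree_mult_eq) auto
        then obtain c where c: "v = [:c:]" by (rule degree_eq_zeroE)
        have c_nz: "c \<noteq> 0" using c v r_nz by auto
        have Fc: "smult c F = [:1, - x i:] * [:1, - x j:] * r"
        proof -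
          have "prod f J = f i * f j" for f :: "nat \<Rightarrow> 'a poly" unfolding ij(1) using ij(2) by simp
          moreover have "r = smult c w" unfolding v c by simp
          ultimately show ?thesis unfolding Fw by (simp only: mult_smult_right)
        qed
        have rel: "c * poly g (symm z) * (Q * z\<^sup>2 - 1)
            = (1 - x i * z) * (1 - x j * z) * (poly g (symm (Q * z)) - poly g (symm z))"
          if z: "z \<noteq> 0" for z
        proof -
          have "c * poly F z = (1 - x i * z) * (1 - x j * z) * poly r z"
            using arg_cong[OF Fc, of "\<lambda>h. poly h z"]
            by (simp only: poly_smult poly_mult) (simp add: mult.commute)
          then have "z ^ m * (c * poly g (symm z) * (Q * z\<^sup>2 - 1))
              = (1 - x i * z) * (1 - x j * z) * ((Q * z\<^sup>2 - 1) * poly r z)"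
            unfolding F[OF z] by (simp add: mult_ac)
          also have "\<dots> = z ^ m * ((1 - x i * z) * (1 - x j * z)
              * (poly g (symm (Q * z)) - poly g (symm z)))"
            unfolding r[OF z] by (simp only: mult_ac)
          finally show ?thesis using z by simp
        qed
        have "r = 0"
        proof (rule poly_eqI_infinite[OF infinite_regular])
          fix z assume "z \<in> {z. regular z}"
          then have z: "regular z" "z \<noteq> 0" "Q * z\<^sup>2 - 1 \<noteq> 0" by (auto simp: regular_def)
          have "poly g (symm (Q * z)) = poly g (symm z)"
            using rel xy z(1) c_nz by (rule shift_invariant_of_relation)
          then show "poly r z = poly 0 z" using r[OF z(2)] z(3) by simp
        qed
        then show ?thesis using r_nz by contradiction
      next
        case False': False
        then have "3 \<le> card J" using cardJ by simp
        then obtain K where K: "K \<subseteq> J" "card K = 3" by (meson obtain_subset_with_card_n)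
        then obtain i j k where ijk: "K = {i, j, k}" "i \<noteq> j" "i \<noteq> k" "j \<noteq> k" by (auto simp: card_3_iff)
        then have ijkJ: "i \<in> J" "j \<in> J" "k \<in> J" using K by auto
        then have prods: "x i * x j = Q" "x i * x k = Q" "x j * x k = Q" using False ijk by blast+
        \<comment> \<open>Three parameters with all pairwise products equal to Q are equal, so they
          contribute a cube to F.\<close>
        have xi: "x i \<noteq> 0" using x ijkJ J by auto
        have "x j = x k" using prods xi by (metis mult_left_cancel)
        moreover have "x i = x j" using prods by (metis Q_nonzero mult.commute mult_left_cancel mult_not_zero)
        ultimately have eq: "x j = x i" "x k = x i" by auto
        have "(\<Prod>l\<in>K. [:1, - x l:]) dvd F"
          unfolding Fw using K finJ by (intro dvd_mult2 prod_dvd_prod_subset) auto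
        moreover have "(\<Prod>l\<in>K. [:1, - x l:]) = [:1, - x i:] ^ 3"
          unfolding ijk(1) using ijk(2-4) eq by (simp add: power3_eq_cube)
        ultimately have cube: "[:1, - x i:] ^ 3 dvd F" by simp
        obtain h where h: "P = g * h" using g(1) by (elim dvdE)
        have "P \<noteq> 0" using degP n3 by auto
        then have degh: "degree h = n - m" unfolding m_def using degP h by (auto simp: degree_mult_eq)
        obtain H where H: "\<And>z. z \<noteq> 0 \<Longrightarrow> poly H z = z ^ (n - m) * poly h (symm z)"
          using hat_poly_exists[of h "n - m" 1] degh by auto
        let ?c = "inverse (x i)"
        have cn: "?c ^ n = s"
          using xs(2)[OF ijkJ(1)] True s(1) by (simp add: power_inverse inverse_unique)
        \<comment> \<open>F H is z^n P(z + 1/z) = z^(2n) - \<kappa> z^n + 1, a perfect square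
          because s^2 = 1 and \<kappa> = 2 s.\<close>
        have "F * H = (monom 1 n - [:?c ^ n:]) ^ 2"
        proof (rule poly_eqI_infinite[OF infinite_regular])
          fix z assume "z \<in> {z. regular z}"
          then have z: "z \<noteq> 0" by (simp add: regular_def)
          have "poly (F * H) z = z ^ m * z ^ (n - m) * poly P (symm z)"
            by (simp add: F H z h mult_ac)
          also have "z ^ m * z ^ (n - m) = z ^ n" using g by (simp add: m_def flip: power_add)
          also have "z ^ n * poly P (symm z) = z ^ n * z ^ n - \<kappa> * z ^ n + 1"
            unfolding P[OF z] using z by (simp add: algebra_simps flip: power_mult_distrib)
          also have "\<kappa> = s + s" using s True by (metis inverse_unique)
          also have "z ^ n * z ^ n - (s + s) * z ^ n + 1 = (z ^ n - s) ^ 2"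
            unfolding True[symmetric] by (simp add: algebra_simps power2_eq_square)
          finally show "poly (F * H) z = poly ((monom 1 n - [:?c ^ n:]) ^ 2) z"
            by (simp add: cn poly_monom)
        qed
        then have "[:1, - x i:] ^ 3 dvd (monom 1 n - [:?c ^ n:]) ^ 2"
          using cube by (metis dvd_mult2)
        moreover have "[:1, - x i:] = smult (- x i) [:- ?c, 1:]" using xi by simp
        then have "[:1, - x i:] ^ 3 = smult ((- x i) ^ 3) ([:- ?c, 1:] ^ 3)" by (simp only: smult_power)
        ultimately have "[:- ?c, 1:] ^ 3 dvd (monom 1 n - [:?c ^ n:]) ^ 2"
          using xi by (simp only: smult_dvd_iff) (simp split: if_splits)
        then show ?thesis using triple_root_not_dvd[of ?c] xi by simp
      qed
    qed
  qed
qed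

end

section \<open>The action of B on the Newton basis\<close>

definition aw_param :: "'a::field \<Rightarrow> 'a \<Rightarrow> 'a \<Rightarrow> 'a \<Rightarrow> 'a \<Rightarrow> nat \<Rightarrow> 'a" where
  "aw_param q a b c lam i = [b * q / c, b * c * q, inverse (a * lam), a / lam] ! i"

lemma aw_param_simps:
  "aw_param q a b c lam 0 = b * q / c" "aw_param q a b c lam 1 = b * c * q"
  "aw_param q a b c lam 2 = inverse (a * lam)" "aw_param q a b c lam 3 = a / lam"
  by (simp_all add: aw_param_def eval_nat_numeral)

definition newton :: "'a::field \<Rightarrow> 'a \<Rightarrow> 'a \<Rightarrow> nat \<Rightarrow> 'a poly" where
  "newton q a lam i = (\<Prod>j<i. [:- theta q a lam j, 1:])"

lemma newton_0 [simp]: "newton q a lam 0 = 1"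
  and newton_Suc: "newton q a lam (Suc i) = newton q a lam i * [:- theta q a lam i, 1:]"
  by (simp_all add: newton_def mult.commute)

lemma degree_newton [simp]: "degree (newton q a lam i) = i"
  unfolding newton_def by (subst degree_prod_eq_sum_degree) auto

lemma newton_nonzero [simp]: "newton q a lam i \<noteq> 0"
  unfolding newton_def by simp

lemma theta_eq_symm: "theta q a lam i = symm (a / lam * (q\<^sup>2) ^ i)"
proof -
  have 1: "q powi (2 * int i) = (q\<^sup>2) ^ i" by (simp add: power_int_mult)
  have 2: "q powi (- 2 * int i) = inverse ((q\<^sup>2) ^ i)"
    by (simp add: power_int_mult power_int_minus power_inverse)
  show ?thesis unfolding theta_def 1 2 by (simp add: divide_inverse mult_ac)
qed

locale askey_wilson = primitive_root "q\<^sup>2" n for q :: "'a::field" and n +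
  fixes a b c lam :: 'a
  assumes nonzero: "a \<noteq> 0" "b \<noteq> 0" "c \<noteq> 0" "lam \<noteq> 0"
begin

abbreviation u :: 'a where "u \<equiv> a / lam"
abbreviation mu :: 'a where "mu \<equiv> b / lam"
abbreviation x :: "nat \<Rightarrow> 'a" where "x \<equiv> aw_param q a b c lam"
abbreviation E :: "nat \<Rightarrow> 'a poly" where "E \<equiv> newton q a lam"

lemma q_nonzero [simp]: "q \<noteq> 0"
  using Q_nonzero by simp

text \<open>Apart from the explicit prefactors, \<open>phi\<close> is the cubic built from x_0, x_1,
  x_2 at the point u Q^i. The fourth factor 1 - u z is missing because the difference of a Newton
  polynomial absorbs it.\<close>

lemma phi_Suc:
  fixes i :: nat
  defines "t \<equiv> (q\<^sup>2) ^ Suc i"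
  shows "phi q a b c lam (Suc i) = - (q\<^sup>2 / (u * mu * t\<^sup>2)) * (t - 1)
    * ((1 - x 0 * (u * (q\<^sup>2) ^ i)) * (1 - x 1 * (u * (q\<^sup>2) ^ i)) * (1 - x 2 * (u * (q\<^sup>2) ^ i)))"
proof -
  define k where "k = q ^ i"
  have k: "k \<noteq> 0" "(q\<^sup>2) ^ i = k\<^sup>2" by (simp_all add: k_def flip: power_mult) (simp add: mult.commute)
  have t: "t = q\<^sup>2 * k\<^sup>2" by (simp add: t_def k)
  have p: "q powi int (Suc i) = q * k" "q powi (- int (Suc i)) = inverse (q * k)"
    "q powi (int (Suc i) - 1) = k" "q powi (1 - int (Suc i)) = inverse k"
  proof -
    show 1: "q powi int (Suc i) = q * k" unfolding power_int_of_nat by (simp add: k_def)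
    show "q powi (- int (Suc i)) = inverse (q * k)" unfolding power_int_minus 1 ..
    have "int (Suc i) - 1 = int i" "1 - int (Suc i) = - int i" by simp_all
    then show "q powi (int (Suc i) - 1) = k" "q powi (1 - int (Suc i)) = inverse k"
      by (simp_all only: power_int_minus power_int_of_nat k_def)
  qed
  have f: "q * k - inverse (q * k) = (t - 1) / (q * k)"
    "inverse lam * k - lam * inverse k = - (lam / k) * (1 - x 2 * (u * k\<^sup>2))"
    "inverse (q * k) - a * b * c * inverse lam * k = (1 - x 1 * (u * k\<^sup>2)) / (q * k)"
    "inverse (q * k) - a * b * inverse c * inverse lam * k = (1 - x 0 * (u * k\<^sup>2)) / (q * k)"
    using nonzero k(1) by (simp_all add: t aw_param_simps[unfolded One_nat_def] field_simps power2_eq_square)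
  show ?thesis
    unfolding phi_def p f k(2)
    using nonzero k(1) by (simp add: t field_simps power2_eq_square)
qed

section \<open>q-differences of Newton polynomials\<close>

lemma symm_diff:
  assumes "z \<noteq> 0" "w \<noteq> 0"
  shows "symm z - symm w = (z - w) * (z - inverse w) / (z::'a)"
  using assms by (simp add: field_simps)

lemma poly_newton_Suc:
  "poly (E (Suc i)) y = poly (E i) y * (y - symm (u * (q\<^sup>2) ^ i))"
proof -
  have "poly [:- theta q a lam i, 1:] y = y - theta q a lam i" by simp
  then show ?thesis unfolding newton_Suc poly_mult theta_eq_symm by (simp only:)
qed

text \<open>E_(i+1)(z + 1/z) is, up to powers of z, the product of z - u Q^j and z - 1/(u Q^j) for j
  \<le> i. Replacing z by Q z shifts the first family one step down and the second one step up. The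
  factor z - 1/u on the left fills the gap in the second, and all that exceeds E_i is three linear
  factors.\<close>

lemma newton_shift:
  assumes z: "z \<noteq> 0"
  shows "(z - inverse u) * poly (E (Suc i)) (symm (q\<^sup>2 * z))
    = poly (E i) (symm z) * (((q\<^sup>2) ^ Suc i * (z - u / q\<^sup>2) * (z - inverse (u * (q\<^sup>2) ^ Suc i)))
        * (z - inverse (u * (q\<^sup>2) ^ i)) / z)"
proof (induction i)
  have d: "symm (q\<^sup>2 * z) - symm (u * (q\<^sup>2) ^ i) = q\<^sup>2 * (z - u * (q\<^sup>2) ^ i / q\<^sup>2) * (z - inverse (u * (q\<^sup>2) ^ Suc i)) / z" for i
  proof -
    have "symm (q\<^sup>2 * z) - symm (u * (q\<^sup>2) ^ i)
        = (q\<^sup>2 * z - u * (q\<^sup>2) ^ i) * (q\<^sup>2 * z - inverse (u * (q\<^sup>2) ^ i)) / (q\<^sup>2 * z)"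
      using z nonzero by (intro symm_diff) auto
    also have "q\<^sup>2 * z - u * (q\<^sup>2) ^ i = q\<^sup>2 * (z - u * (q\<^sup>2) ^ i / q\<^sup>2)"
      by (simp add: right_diff_distrib)
    also have "q\<^sup>2 * z - inverse (u * (q\<^sup>2) ^ i) = q\<^sup>2 * (z - inverse (u * (q\<^sup>2) ^ Suc i))"
      using nonzero by (simp add: right_diff_distrib)
    also have "q\<^sup>2 * A * (q\<^sup>2 * B) / (q\<^sup>2 * z) = q\<^sup>2 * A * B / z" for A B by simp
    finally show ?thesis .
  qed
  {
    case 0
    have "(z - inverse u) * poly (E (Suc 0)) (symm (q\<^sup>2 * z))
        = (z - inverse u) * (symm (q\<^sup>2 * z) - symm (u * (q\<^sup>2) ^ 0))"
      by (simp add: newton_Suc theta_eq_symm)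
    then show ?case unfolding d by (simp add: mult_ac)
  next
    case (Suc i)
    have E2: "poly (E (Suc (Suc i))) (symm (q\<^sup>2 * z))
        = poly (E (Suc i)) (symm (q\<^sup>2 * z)) * (symm (q\<^sup>2 * z) - symm (u * (q\<^sup>2) ^ Suc i))"
      by (rule poly_newton_Suc)
    have E1: "poly (E (Suc i)) (symm z) = poly (E i) (symm z) * (symm z - symm (u * (q\<^sup>2) ^ i))"
      by (rule poly_newton_Suc)
    have s: "symm z - symm (u * (q\<^sup>2) ^ i) = (z - u * (q\<^sup>2) ^ i) * (z - inverse (u * (q\<^sup>2) ^ i)) / z"
      using z nonzero by (intro symm_diff) auto
    have c: "u * (q\<^sup>2) ^ Suc i / q\<^sup>2 = u * (q\<^sup>2) ^ i" by simp
    have "(z - inverse u) * poly (E (Suc (Suc i))) (symm (q\<^sup>2 * z))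
        = ((z - inverse u) * poly (E (Suc i)) (symm (q\<^sup>2 * z))) * (symm (q\<^sup>2 * z) - symm (u * (q\<^sup>2) ^ Suc i))"
      unfolding E2 by (simp only: mult_ac)
    moreover have "P * (S * A * B1 * B0 / z) * (K * C * B2 / z) = P * (C * B0 / z) * (K * S * A * B2 * B1 / z)"
      for P S A B0 B1 B2 C K by (simp add: mult_ac)
    ultimately show ?case
      unfolding Suc d c E1 s power_Suc[of "q\<^sup>2" "Suc i"] by (simp only:)
  }
qed

lemma newton_difference:
  assumes z: "z \<noteq> 0"
  shows "(z - inverse u) * (poly (E (Suc i)) (symm (q\<^sup>2 * z)) - poly (E (Suc i)) (symm z))
    = poly (E i) (symm z) * (((q\<^sup>2) ^ Suc i - 1) / q\<^sup>2) * ((q\<^sup>2 * z\<^sup>2 - 1) * (z - inverse (u * (q\<^sup>2) ^ i)) / z)"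
proof -
  define s where "s = (q\<^sup>2) ^ i"
  have s: "s \<noteq> 0" by (simp add: s_def)
  have E1: "poly (E (Suc i)) (symm z) = poly (E i) (symm z) * ((z - u * s) * (z - inverse (u * s)) / z)"
  proof -
    have "symm z - symm (u * s) = (z - u * s) * (z - inverse (u * s)) / z"
      using z nonzero s by (intro symm_diff) auto
    moreover have "poly (E (Suc i)) (symm z) = poly (E i) (symm z) * (symm z - symm (u * s))"
      unfolding s_def by (rule poly_newton_Suc)
    ultimately show ?thesis by (simp only:)
  qed
  \<comment> \<open>The linear terms of the two quadratics cancel, leaving a multiple of Q z^2 - 1,
    exactly the factor needed against the pole of \<open>aw_term\<close>.\<close>
  have k: "q\<^sup>2 * s * (z - u / q\<^sup>2) * (z - inverse (u * (q\<^sup>2 * s))) - (z - inverse u) * (z - u * s)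
      = (q\<^sup>2 * s - 1) / q\<^sup>2 * (q\<^sup>2 * z\<^sup>2 - 1)"
    using s nonzero by (simp add: field_simps power2_eq_square)
  have "(z - inverse u) * (poly (E (Suc i)) (symm (q\<^sup>2 * z)) - poly (E (Suc i)) (symm z))
     = poly (E i) (symm z) * ((q\<^sup>2 * s * (z - u / q\<^sup>2) * (z - inverse (u * (q\<^sup>2 * s))))
        * (z - inverse (u * s)) / z)
       - (z - inverse u) * (poly (E i) (symm z) * ((z - u * s) * (z - inverse (u * s)) / z))"
    unfolding right_diff_distrib[of "z - inverse u"] newton_shift[OF z] E1
    unfolding s_def power_Suc by (rule refl)
  also have "\<dots> = poly (E i) (symm z) * ((z - inverse (u * s)) / z)
      * (q\<^sup>2 * s * (z - u / q\<^sup>2) * (z - inverse (u * (q\<^sup>2 * s))) - (z - inverse u) * (z - u * s))"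
  proof -
    have "H * (X * V / z) - Y * (H * (W * V / z)) = H * (V / z) * (X - Y * W)" for H X V Y W
      by (simp add: algebra_simps diff_divide_distrib)
    then show ?thesis .
  qed
  also have "\<dots> = poly (E i) (symm z) * ((q\<^sup>2 * s - 1) / q\<^sup>2) * ((q\<^sup>2 * z\<^sup>2 - 1) * (z - inverse (u * s)) / z)"
  proof -
    have "H * (W / z) * (T / q\<^sup>2 * R) = H * (T / q\<^sup>2) * (R * W / z)" for H W T R
      by (simp add: mult_ac)
    then show ?thesis unfolding k .
  qed
  finally show ?thesis by (simp only: s_def power_Suc)
qed

text \<open>The sum is symmetric under z -> 1/z and its poles at z^2 = 1 cancel, so it is affine in
  z + 1/z. The constant is read off at z = w, where the first summand drops out.\<close>

lemma cubic_partial_fraction: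
  fixes z w x0 x1 x2 :: 'a
  defines "p \<equiv> \<lambda>y. (1 - x0 * y) * (1 - x1 * y) * (1 - x2 * y)"
  assumes z: "z \<noteq> 0" "1 - z\<^sup>2 \<noteq> 0" and w: "w \<noteq> 0"
  shows "p z * (z - w) / (z * (1 - z\<^sup>2)) + p (inverse z) * (inverse z - w) / (inverse z * (1 - (inverse z)\<^sup>2))
    = (x0 * x1 * x2 - w) * (symm z - symm w) - w\<^sup>2 * p (inverse w)"
proof -
  define e1 where "e1 = x0 + x1 + x2"
  define e2 where "e2 = x0 * x1 + x0 * x2 + x1 * x2"
  define e3 where "e3 = x0 * x1 * x2"
  have p: "p y = 1 - e1 * y + e2 * y\<^sup>2 - e3 * y ^ 3" for y
    by (simp add: p_def e1_def e2_def e3_def algebra_simps power2_eq_square power3_eq_cube)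
  have i: "inverse z * (1 - (inverse z)\<^sup>2) = - (1 - z\<^sup>2) / z ^ 3"
    using z by (simp add: field_simps power2_eq_square power3_eq_cube)
  have "p (inverse z) * (inverse z - w) = (z ^ 3 - e1 * z\<^sup>2 + e2 * z - e3) * (1 - w * z) / z ^ 4"
    unfolding p using z by (simp add: field_simps power2_eq_square power3_eq_cube power4_eq_xxxx)
  then have "p (inverse z) * (inverse z - w) / (inverse z * (1 - (inverse z)\<^sup>2))
      = - ((z ^ 3 - e1 * z\<^sup>2 + e2 * z - e3) * (1 - w * z)) / (z * (1 - z\<^sup>2))"
  proof -
    have "N / z ^ 4 / (- D / z ^ 3) = - N / (z * D)" if "D \<noteq> 0" for N D
      using that z by (simp add: field_simps power3_eq_cube power4_eq_xxxx)
    then show ?thesis unfolding i using z \<open>p (inverse z) * (inverse z - w) = _\<close> by (simp only:)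
  qed
  then have "p z * (z - w) / (z * (1 - z\<^sup>2)) + p (inverse z) * (inverse z - w) / (inverse z * (1 - (inverse z)\<^sup>2))
      = (p z * (z - w) - (z ^ 3 - e1 * z\<^sup>2 + e2 * z - e3) * (1 - w * z)) / (z * (1 - z\<^sup>2))"
    by (simp add: diff_divide_distrib)
  also have "p z * (z - w) - (z ^ 3 - e1 * z\<^sup>2 + e2 * z - e3) * (1 - w * z)
      = (z * (1 - z\<^sup>2)) * ((e3 - w) * symm z + (1 + w * e1 - e2 - w * e3))"
    unfolding p using z by (simp add: field_simps power2_eq_square power3_eq_cube)
  also have "\<dots> / (z * (1 - z\<^sup>2)) = (e3 - w) * symm z + (1 + w * e1 - e2 - w * e3)" using z by simp
  also have "\<dots> = (e3 - w) * (symm z - symm w) - w\<^sup>2 * p (inverse w)"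
    unfolding p using w by (simp add: field_simps power2_eq_square power3_eq_cube)
  finally show ?thesis by (simp only: e3_def)
qed

text \<open>The difference turns E_i into E_(i-1) times an expression affine in z + 1/z. Expanding
  it around \<open>symm w\<close>, the last node of E_i, makes one part a multiple of E_i and leaves
  a multiple of E_(i-1): the bidiagonal action of B.\<close>

lemma aw_newton:
  "aw x mu (E i) (smult (theta q b lam i) (E i)
     + (if i = 0 then 0 else smult (phi q a b c lam i) (E (i - 1))))"
proof (cases i)
  case 0
  then show ?thesis by (simp add: aw_def aw_term_def theta_eq_symm)
next
  case (Suc i')
  show ?thesis
    unfolding aw_def
  proof (intro allI impI)
    fix z assume z: "regular z"
    then have nz: "z \<noteq> 0" "1 - z\<^sup>2 \<noteq> 0" "1 - q\<^sup>2 * z\<^sup>2 \<noteq> 0" and z': "regular (inverse z)"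
      by (auto simp: regular_def power_inverse field_simps)
    then have nz': "inverse z \<noteq> 0" "1 - (inverse z)\<^sup>2 \<noteq> 0" "1 - q\<^sup>2 * (inverse z)\<^sup>2 \<noteq> 0"
      by (auto simp: regular_def)
    define t where "t = (q\<^sup>2) ^ Suc i'"
    define w where "w = inverse (u * (q\<^sup>2) ^ i')"
    define G where "G = poly (E i') (symm z)"
    define p where "p y = (1 - x 0 * y) * (1 - x 1 * y) * (1 - x 2 * y)" for y
    have w: "w \<noteq> 0" "w = q\<^sup>2 / (u * t)" using nonzero by (simp_all add: w_def t_def)
    have t: "t \<noteq> 0" by (simp add: t_def)
    have awt: "aw_term x (E i) y = (u * (t - 1) / q\<^sup>2) * poly (E i') (symm y) * (p y * (y - w) / (y * (1 - y\<^sup>2)))"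
      if y: "y \<noteq> 0" "1 - y\<^sup>2 \<noteq> 0" "1 - q\<^sup>2 * y\<^sup>2 \<noteq> 0" for y
    proof -
      have p4: "(\<Prod>i<4. 1 - x i * y) = p y * (- u * (y - inverse u))"
      proof -
        have "(\<Prod>i<4. f i) = f 0 * f 1 * f 2 * f 3" for f :: "nat \<Rightarrow> 'a"
          by (simp add: eval_nat_numeral mult_ac)
        moreover have "1 - x 3 * y = - u * (y - inverse u)"
          unfolding aw_param_simps using nonzero by (simp add: field_simps)
        ultimately show ?thesis by (simp only: p_def)
      qed
      have "aw_term x (E i) y = p y * (- u) / ((1 - y\<^sup>2) * (1 - q\<^sup>2 * y\<^sup>2))
          * ((y - inverse u) * (poly (E (Suc i')) (symm (q\<^sup>2 * y)) - poly (E (Suc i')) (symm y)))"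
        unfolding aw_term_def p4 Suc by simp
      also have "\<dots> = p y * (- u) / ((1 - y\<^sup>2) * (1 - q\<^sup>2 * y\<^sup>2))
          * (poly (E i') (symm y) * ((t - 1) / q\<^sup>2) * (- (1 - q\<^sup>2 * y\<^sup>2) * (y - w) / y))"
        unfolding newton_difference[OF y(1)] by (simp add: t_def w_def)
      also have "\<dots> = (u * (t - 1) / q\<^sup>2) * poly (E i') (symm y) * (p y * (y - w) / (y * (1 - y\<^sup>2)))"
      proof -
        have "P * (- u) / (A * B) * (H * (T / q\<^sup>2) * (- B * W / y)) = (u * T / q\<^sup>2) * H * (P * W / (y * A))"
          if "B \<noteq> 0" for P A B H T W using that by (simp add: mult_ac)
        then show ?thesis using y(3) .
      qed
      finally show ?thesis .
    qed
    have "aw_term x (E i) z + aw_term x (E i) (inverse z)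
      = (u * (t - 1) / q\<^sup>2) * G * (p z * (z - w) / (z * (1 - z\<^sup>2))
          + p (inverse z) * (inverse z - w) / (inverse z * (1 - (inverse z)\<^sup>2)))"
      unfolding awt[OF nz] awt[OF nz'] poly_symm_Q_inverse(3)[OF nz(1)] G_def[symmetric]
      by (simp only: distrib_left)
    also have "\<dots> = (u * (t - 1) / q\<^sup>2) * G
        * ((x 0 * x 1 * x 2 - w) * (symm z - symm w) - w\<^sup>2 * p (inverse w))"
      unfolding p_def cubic_partial_fraction[OF nz(1,2) w(1)] ..
    finally have S: "aw_term x (E i) z + aw_term x (E i) (inverse z) = \<dots>" .
    have e3: "x 0 * x 1 * x 2 = mu\<^sup>2 * q\<^sup>2 / u"
      unfolding aw_param_simps using nonzero by (simp add: field_simps power2_eq_square)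
    have th: "theta q b lam i = symm (mu * t)" by (simp add: theta_eq_symm Suc t_def)
    have "symm w = symm (u * (q\<^sup>2) ^ i')" unfolding w_def poly_symm_Q_inverse inverse_inverse_eq by (rule add.commute)
    then have E: "poly (E i) (symm z) = G * (symm z - symm w)"
      unfolding Suc poly_newton_Suc G_def by (simp only:)
    have ph: "phi q a b c lam i = - (q\<^sup>2 / (u * mu * t\<^sup>2)) * (t - 1) * p (inverse w)"
      unfolding Suc phi_Suc by (simp add: t_def p_def w_def)
    have scal: "(u * T / q\<^sup>2 * G * ((mu\<^sup>2 * q\<^sup>2 / u - w) * X - w\<^sup>2 * V)) / mu
        = T * (mu - inverse (mu * t)) * (G * X) + - (q\<^sup>2 / (u * mu * t\<^sup>2)) * T * V * G" for T X V
    proof -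
      have "(U * T / k * G * ((m\<^sup>2 * k / U - k / (U * t)) * X - (k / (U * t))\<^sup>2 * V)) / m
        = T * (m - inverse (m * t)) * (G * X) + - (k / (U * m * t\<^sup>2)) * T * V * G"
        if "U \<noteq> 0" "m \<noteq> 0" "k \<noteq> 0" for U m k :: 'a
        using that t by (simp add: field_simps power2_eq_square)
      moreover have "u \<noteq> 0" "mu \<noteq> 0" "q\<^sup>2 \<noteq> 0" using nonzero by simp_all
      ultimately show ?thesis unfolding w(2) .
    qed
    \<comment> \<open>The difference part contributes (t - 1) (mu - 1/(mu t)) to the diagonal; the
      eigenvalue on constants completes it to the eigenvalue mu t + 1/(mu t).\<close>
    have sm: "symm (mu * t) = (t - 1) * (mu - inverse (mu * t)) + symm mu"
      using nonzero t by (simp add: field_simps)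
    have lhs: "poly (smult (theta q b lam i) (E i)
        + (if i = 0 then 0 else smult (phi q a b c lam i) (E (i - 1)))) (symm z)
      = theta q b lam i * poly (E i) (symm z) + phi q a b c lam i * G"
      by (simp add: Suc G_def)
    have "(A + B) * X + F = A * X + F + B * X" for A B X F :: 'a by (simp add: algebra_simps)
    then show "poly (smult (theta q b lam i) (E i)
        + (if i = 0 then 0 else smult (phi q a b c lam i) (E (i - 1)))) (symm z)
      = (aw_term x (E i) z + aw_term x (E i) (inverse z)) / mu + symm mu * poly (E i) (symm z)"
      unfolding lhs unfolding S e3 scal th sm E ph .
  qed
qed

end

section \<open>Submodules as stable ideals\<close>

lemma is_subspace_Mspace: "is_subspace (Mspace :: (nat \<Rightarrow> 'a::field) set)"
  unfolding is_subspace_def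
proof (intro conjI ballI allI)
  fix v w :: "nat \<Rightarrow> 'a" and t assume vw: "v \<in> Mspace" "w \<in> Mspace"
  have "{i. v i + w i \<noteq> 0} \<subseteq> {i. v i \<noteq> 0} \<union> {i. w i \<noteq> 0}" by auto
  from finite_subset[OF this] show "(\<lambda>i. v i + w i) \<in> Mspace" using vw by (simp add: Mspace_def)
next
  fix v :: "nat \<Rightarrow> 'a" and t assume v: "v \<in> Mspace"
  have "{i. t * v i \<noteq> 0} \<subseteq> {i. v i \<noteq> 0}" by auto
  from finite_subset[OF this] show "(\<lambda>i. t * v i) \<in> Mspace" using v by (simp add: Mspace_def)
qed (auto simp: Mspace_def)

lemma subspaceD:
  assumes "is_subspace U"
  shows "U \<subseteq> Mspace" "(\<lambda>_. 0) \<in> U" "v \<in> U \<Longrightarrow> w \<in> U \<Longrightarrow> (\<lambda>i. v i + w i) \<in> U"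
    "v \<in> U \<Longrightarrow> (\<lambda>i. t * v i) \<in> U"
  using assms unfolding is_subspace_def by blast+

lemma lspan_least: "is_subspace U \<Longrightarrow> S \<subseteq> U \<Longrightarrow> lspan S \<subseteq> U"
  unfolding lspan_def by blast

lemma lspan_superset: "S \<subseteq> lspan S"
  unfolding lspan_def by blast

lemma is_subspace_lspan:
  assumes "S \<subseteq> Mspace"
  shows "is_subspace (lspan S)"
  unfolding is_subspace_def
proof (intro conjI ballI allI)
  show "lspan S \<subseteq> Mspace" using assms is_subspace_Mspace by (intro lspan_least)
qed (auto simp: lspan_def dest: subspaceD)

text \<open>C is a scalar minus a combination of AB and BA, so it preserves whatever subspace A and
  B preserve.\<close>

lemma is_submoduleI:
  assumes U: "is_subspace U" and A: "\<And>v. v \<in> U \<Longrightarrow> actA q a lam v \<in> U"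
    and B: "\<And>v. v \<in> U \<Longrightarrow> actB q a b c lam v \<in> U"
  shows "is_submodule q a b c lam U"
  unfolding is_submodule_def
proof (intro conjI ballI U A B)
  fix v assume v: "v \<in> U"
  define r where "r = q ^ 2 - inverse q ^ 2"
  have "(\<lambda>i. gam q a b c lam / (q + inverse q) * v i
      + (- (q / r) * actA q a lam (actB q a b c lam v) i
        + inverse q / r * actB q a b c lam (actA q a lam v) i)) \<in> U"
    by (intro subspaceD(3,4)[OF U] A B v)
  moreover have "actC q a b c lam v = (\<lambda>i. gam q a b c lam / (q + inverse q) * v i
      + (- (q / r) * actA q a lam (actB q a b c lam v) i
        + inverse q / r * actB q a b c lam (actA q a lam v) i))"
    by (rule ext) (simp add: actC_def r_def diff_divide_distrib)
  ultimately show "actC q a b c lam v \<in> U" by simp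
qed

lemma Mspace_bound:
  assumes "v \<in> Mspace"
  obtains N where "\<And>i. i \<ge> N \<Longrightarrow> v i = 0"
proof -
  obtain k where "\<forall>i\<in>{i. v i \<noteq> 0}. i \<le> k"
    using assms finite_nat_set_iff_bounded_le unfolding Mspace_def by blast
  then show thesis using that[of "Suc k"] by fastforce
qed

lemma MspaceI:
  assumes "\<And>i. i \<ge> N \<Longrightarrow> v i = 0"
  shows "v \<in> Mspace"
proof -
  have "{i. v i \<noteq> 0} \<subseteq> {..<N}" using assms by (auto simp: not_le[symmetric])
  then show ?thesis unfolding Mspace_def by (auto intro: finite_subset)
qed

lemma mbasis_Mspace: "mbasis i \<in> Mspace"
  by (rule MspaceI[of "Suc i"]) (simp add: mbasis_def)

lemma coeff_newton_self [simp]: "coeff (newton q a lam i) i = 1"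
proof -
  have "lead_coeff (newton q a lam i) = 1" unfolding newton_def by (simp add: lead_coeff_prod)
  then show ?thesis by simp
qed

text \<open>There is one monic Newton polynomial in each degree, so subtracting a multiple of it
  removes the top coefficient. The predicate form serves both the surjectivity of \<open>Phi\<close>
  and the description of N.\<close>

lemma newton_span:
  assumes zero: "R 0" and add: "\<And>f g. R f \<Longrightarrow> R g \<Longrightarrow> R (f + g)"
    and smult: "\<And>t f. R f \<Longrightarrow> R (smult t f)" and newton: "\<And>i. R (newton q a lam i)"
  shows "R f"
proof -
  have "\<forall>f. (\<forall>i\<ge>N. coeff f i = 0) \<longrightarrow> R f" for N
  proof (induction N)
    case 0
    then show ?case using zero by (metis leading_coeff_0_iff le0)
  next
    case (Suc N)
    show ?case
    proof (intro allI impI)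
      fix f :: "'a poly" assume f: "\<forall>i\<ge>Suc N. coeff f i = 0"
      define g where "g = f - smult (coeff f N) (newton q a lam N)"
      have "coeff g i = 0" if "i \<ge> N" for i
      proof (cases "i = N")
        case False
        then have "coeff (newton q a lam N) i = 0" "coeff f i = 0"
          using that f by (auto intro: coeff_eq_0)
        then show ?thesis by (simp add: g_def)
      qed (simp add: g_def)
      then have "R g" using Suc.IH by blast
      then have "R (g + smult (coeff f N) (newton q a lam N))" by (intro add smult newton)
      then show "R f" by (simp add: g_def)
    qed
  qed
  then show ?thesis using coeff_eq_0[of f] by (metis Suc_le_lessD)
qed

section \<open>The linear bijection from M to F[X] and the actions of A and B\<close>

context askey_wilson
begin

text \<open>Meaningful on \<open>Mspace\<close> only: for infinite support the sum defaults to
  0.\<close>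

definition Phi :: "(nat \<Rightarrow> 'a) \<Rightarrow> 'a poly" where
  "Phi v = (\<Sum>i | v i \<noteq> 0. smult (v i) (E i))"

lemma Phi_eq_sum:
  assumes "\<And>i. i \<ge> N \<Longrightarrow> v i = 0"
  shows "Phi v = (\<Sum>i<N. smult (v i) (E i))"
  unfolding Phi_def
  by (rule sum.mono_neutral_left) (use assms in \<open>auto simp: not_le[symmetric]\<close>)

lemma Phi_add:
  assumes "v \<in> Mspace" "w \<in> Mspace"
  shows "Phi (\<lambda>i. v i + w i) = Phi v + Phi w"
proof -
  obtain N where N: "\<And>i. i \<ge> N \<Longrightarrow> v i = 0" using assms(1) by (rule Mspace_bound) blast
  obtain N' where N': "\<And>i. i \<ge> N' \<Longrightarrow> w i = 0" using assms(2) by (rule Mspace_bound) blast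
  show ?thesis
    using Phi_eq_sum[of "max N N'" v] Phi_eq_sum[of "max N N'" w]
      Phi_eq_sum[of "max N N'" "\<lambda>i. v i + w i"] N N'
    by (simp add: smult_add_left sum.distrib)
qed

lemma Phi_smult:
  assumes "v \<in> Mspace"
  shows "Phi (\<lambda>i. t * v i) = smult t (Phi v)"
proof -
  obtain N where N: "\<And>i. i \<ge> N \<Longrightarrow> v i = 0" using assms(1) by (rule Mspace_bound) blast
  have "smult t (\<Sum>i<N. f i) = (\<Sum>i<N. smult t (f i))" for f :: "nat \<Rightarrow> 'a poly"
    by (induction N) (auto simp: smult_add_right)
  then show ?thesis
    using Phi_eq_sum[of N v] Phi_eq_sum[of N "\<lambda>i. t * v i"] N by simp
qed

lemma Phi_zero [simp]: "Phi (\<lambda>_. 0) = 0"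
  by (simp add: Phi_def)

lemma Phi_mbasis [simp]: "Phi (mbasis i) = E i"
proof -
  have "{j. mbasis i j \<noteq> (0::'a)} = {i}" by (auto simp: mbasis_def)
  then show ?thesis by (simp add: Phi_def mbasis_def)
qed

lemma newton_sum_eq_0:
  assumes "(\<Sum>i<N. smult (v i) (E i)) = 0" "i < N"
  shows "v i = 0"
  using assms
proof (induction N)
  case (Suc N)
  have "coeff (\<Sum>i<N. smult (v i) (E i)) N = 0"
    by (simp add: coeff_sum coeff_eq_0)
  moreover have "coeff (\<Sum>i<Suc N. smult (v i) (E i)) N = 0" using Suc.prems by simp
  ultimately have "v N = 0" by simp
  then show ?case using Suc by (cases "i = N") auto
qed simp

lemma Phi_inj:
  assumes "v \<in> Mspace" "w \<in> Mspace" "Phi v = Phi w"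
  shows "v = w"
proof -
  define d where "d = (\<lambda>i. v i + (-1) * w i)"
  have w': "(\<lambda>i. (-1) * w i) \<in> Mspace" using subspaceD(4)[OF is_subspace_Mspace assms(2)] .
  have d: "d \<in> Mspace" unfolding d_def using subspaceD(3)[OF is_subspace_Mspace assms(1) w'] .
  then obtain N where N: "\<And>i. i \<ge> N \<Longrightarrow> d i = 0" by (rule Mspace_bound) blast
  have "Phi d = 0"
    unfolding d_def Phi_add[OF assms(1) w'] Phi_smult[OF assms(2)] using assms(3) by simp
  then have "(\<Sum>i<N. smult (d i) (E i)) = 0" using Phi_eq_sum[OF N] by simp
  then have "d i = 0" for i using N newton_sum_eq_0 by (metis not_le)
  then show ?thesis by (auto simp: d_def)
qed

lemma Phi_surj: "\<exists>v\<in>Mspace. Phi v = f"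
proof (rule newton_span[of _ q a lam])
  show "\<exists>v\<in>Mspace. Phi v = 0" using subspaceD(2)[OF is_subspace_Mspace] Phi_zero by blast
  show "\<exists>v\<in>Mspace. Phi v = E i" for i using mbasis_Mspace Phi_mbasis by blast
  fix f g assume "\<exists>v\<in>Mspace. Phi v = f" "\<exists>v\<in>Mspace. Phi v = g"
  then show "\<exists>v\<in>Mspace. Phi v = f + g"
    using subspaceD(3)[OF is_subspace_Mspace] Phi_add by metis
next
  fix t f assume "\<exists>v\<in>Mspace. Phi v = f"
  then show "\<exists>v\<in>Mspace. Phi v = smult t f"
    using subspaceD(4)[OF is_subspace_Mspace] Phi_smult by metis
qed

lemma actA_Mspace: "v \<in> Mspace \<Longrightarrow> actA q a lam v \<in> Mspace"
  by (erule Mspace_bound, rule_tac N = "Suc N" in MspaceI) (auto simp: actA_def)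

lemma actB_Mspace: "v \<in> Mspace \<Longrightarrow> actB q a b c lam v \<in> Mspace"
  by (erule Mspace_bound, rule_tac N = N in MspaceI) (auto simp: actB_def)

lemma Phi_actA:
  assumes "v \<in> Mspace"
  shows "Phi (actA q a lam v) = [:0, 1:] * Phi v"
proof -
  obtain N where N: "\<And>i. i \<ge> N \<Longrightarrow> v i = 0" using assms(1) by (rule Mspace_bound) blast
  have X: "[:0, 1:] * E i = E (Suc i) + smult (theta q a lam i) (E i)" for i
    by (simp add: newton_Suc)
  have "Phi (actA q a lam v) = (\<Sum>i<Suc N. smult (actA q a lam v i) (E i))"
    by (rule Phi_eq_sum) (use N in \<open>auto simp: actA_def\<close>)
  also have "\<dots> = (\<Sum>i<Suc N. smult (theta q a lam i * v i) (E i))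
      + (\<Sum>i<Suc N. smult (if i = 0 then 0 else v (i - 1)) (E i))"
    by (simp only: actA_def smult_add_left sum.distrib)
  also have "(\<Sum>i<Suc N. smult (if i = 0 then 0 else v (i - 1)) (E i)) = (\<Sum>i<N. smult (v i) (E (Suc i)))"
    by (subst sum.lessThan_Suc_shift) simp
  also have "(\<Sum>i<Suc N. smult (theta q a lam i * v i) (E i)) = (\<Sum>i<N. smult (theta q a lam i * v i) (E i))"
    using N by simp
  also have "\<dots> + (\<Sum>i<N. smult (v i) (E (Suc i))) = (\<Sum>i<N. smult (v i) ([:0, 1:] * E i))"
    unfolding X by (simp add: smult_add_right sum.distrib mult.commute)
  also have "\<dots> = [:0, 1:] * Phi v"
  proof -
    have Phi: "Phi v = (\<Sum>i<N. smult (v i) (E i))" using N by (rule Phi_eq_sum)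
    show ?thesis unfolding Phi sum_distrib_left by (simp only: mult_smult_right)
  qed
  finally show ?thesis .
qed

lemma aw_term_add: "aw_term y (f + g) z = aw_term y f z + aw_term y g z"
proof -
  have "k * (F + G - (F' + G')) = k * (F - F') + k * (G - G')" for k F G F' G' :: 'a
    by (simp add: algebra_simps)
  then show ?thesis unfolding aw_term_def poly_add .
qed

lemma aw_term_smult: "aw_term y (smult t f) z = t * aw_term y f z"
proof -
  have "k * (t * F - t * F') = t * (k * (F - F'))" for k F F' :: 'a
    by (simp add: algebra_simps)
  then show ?thesis unfolding aw_term_def poly_smult .
qed

lemma aw_add:
  assumes "aw y \<mu> f f'" "aw y \<mu> g g'"
  shows "aw y \<mu> (f + g) (f' + g')"
proof -
  have "(A + B) / \<mu> + k * F + ((A' + B') / \<mu> + k * G) = (A + A' + (B + B')) / \<mu> + k * (F + G)"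
    for A B A' B' k F G by (simp add: algebra_simps add_divide_distrib)
  then show ?thesis using assms unfolding aw_def aw_term_add poly_add by simp
qed

lemma aw_smult:
  assumes "aw y \<mu> f f'"
  shows "aw y \<mu> (smult t f) (smult t f')"
proof -
  have "t * ((A + B) / \<mu> + k * F) = (t * A + t * B) / \<mu> + k * (t * F)"
    for A B k F by (simp add: algebra_simps add_divide_distrib)
  then show ?thesis using assms unfolding aw_def aw_term_smult poly_smult by simp
qed

lemma aw_sum: "(\<And>i::nat. aw y \<mu> (f i) (g i)) \<Longrightarrow> aw y \<mu> (\<Sum>i<N. f i) (\<Sum>i<N. g i)"
proof (induction N)
  case 0
  then show ?case by (simp add: aw_def aw_term_def)
next
  case (Suc N)
  then show ?case unfolding sum.lessThan_Suc by (intro aw_add) auto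
qed

lemma aw_Phi_actB:
  assumes "v \<in> Mspace"
  shows "aw x mu (Phi v) (Phi (actB q a b c lam v))"
proof -
  obtain N where N: "\<And>i. i \<ge> N \<Longrightarrow> v i = 0" using assms(1) by (rule Mspace_bound) blast
  let ?th = "theta q b lam" and ?ph = "phi q a b c lam"
  have "aw x mu (\<Sum>i<Suc N. smult (v i) (E i)) (\<Sum>i<Suc N. smult (v i)
      (smult (?th i) (E i) + (if i = 0 then 0 else smult (?ph i) (E (i - 1)))))"
    by (intro aw_sum aw_smult aw_newton)
  also have "(\<Sum>i<Suc N. smult (v i) (E i)) = Phi v"
    by (rule Phi_eq_sum[symmetric]) (use N in auto)
  also have "(\<Sum>i<Suc N. smult (v i) (smult (?th i) (E i) + (if i = 0 then 0 else smult (?ph i) (E (i - 1)))))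
    = (\<Sum>i<Suc N. smult (?th i * v i) (E i))
      + (\<Sum>i<Suc N. smult (v i) (if i = 0 then 0 else smult (?ph i) (E (i - 1))))"
    by (simp only: smult_add_right sum.distrib smult_smult mult.commute)
  also have "(\<Sum>i<Suc N. smult (v i) (if i = 0 then 0 else smult (?ph i) (E (i - 1))))
      = (\<Sum>i<N. smult (?ph (Suc i) * v (Suc i)) (E i))"
    by (subst sum.lessThan_Suc_shift) (simp add: mult.commute)
  also have "(\<Sum>i<Suc N. smult (?th i * v i) (E i)) = (\<Sum>i<N. smult (?th i * v i) (E i))"
    using N by simp
  also have "\<dots> + (\<Sum>i<N. smult (?ph (Suc i) * v (Suc i)) (E i)) = (\<Sum>i<N. smult (actB q a b c lam v i) (E i))"
    by (simp only: actB_def smult_add_left sum.distrib)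
  also have "\<dots> = Phi (actB q a b c lam v)"
    by (rule Phi_eq_sum[symmetric]) (use N in \<open>auto simp: actB_def\<close>)
  finally show ?thesis .
qed

lemma aw_total: "\<exists>f'. aw x mu f f'"
  using Phi_surj[of f] aw_Phi_actB by blast

section \<open>The principal ideal that defines W\<close>

lemma theta_periodic: "theta q a lam (n + i) = theta q a lam i"
  unfolding theta_eq_symm using Qn by (simp add: power_add)

text \<open>Q^n = 1 makes the nodes n-periodic. Hence each generator of N becomes a multiple of the
  single polynomial E_n - delta.\<close>

lemma newton_periodic: "E (n + i) = E n * E i"
  by (induction i) (simp_all add: newton_Suc theta_periodic mult_ac del: mult_pCons_right)

definition charpoly :: "'a \<Rightarrow> 'a poly" where
  "charpoly del = E n - [:del:]"

lemma degree_charpoly: "degree (charpoly del) = n"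
proof -
  have "degree (E n + [:- del:]) = degree (E n)" using n3 by (intro degree_add_eq_left) simp
  moreover have "charpoly del = E n + [:- del:]" by (simp add: charpoly_def)
  ultimately show ?thesis by (simp only: degree_newton)
qed

text \<open>Each factor z + 1/z - (w + 1/w) equals (z - w) (1/z - w) / (0 - w). Over w = u Q^j each
  of the three resulting products has the form Y^n - u^n, for Y = z, 1/z and 0.\<close>

lemma poly_charpoly_symm:
  assumes z: "z \<noteq> 0"
  shows "poly (charpoly del) (symm z)
    = z ^ n + inverse z ^ n - (del + a ^ n * inverse lam ^ n + inverse a ^ n * lam ^ n)"
proof -
  have un: "u \<noteq> 0" "u ^ n \<noteq> 0" using nonzero by simp_all
  have E: "poly (E i) (symm z) = (\<Prod>j<i. symm z - symm (u * (q\<^sup>2) ^ j))" for i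
    by (induction i) (simp_all only: newton_0 poly_1 poly_newton_Suc prod.lessThan_Suc lessThan_0 prod.empty)
  \<comment> \<open>The denominator is written as 0 - w so that \<open>prod_power_root_eval\<close>
    applies to it at the point 0.\<close>
  have f: "symm z - symm w = (z - w) * (inverse z - w) * inverse (0 - w)" if "w \<noteq> 0" for w :: 'a
    using that z by (simp add: field_simps)
  have "poly (E n) (symm z) = (\<Prod>j<n. (z - u * (q\<^sup>2) ^ j) * (inverse z - u * (q\<^sup>2) ^ j) * inverse (0 - u * (q\<^sup>2) ^ j))"
    unfolding E using un by (intro prod.cong f refl) auto
  also have "\<dots> = (z ^ n - u ^ n) * (inverse z ^ n - u ^ n) * inverse (0 ^ n - u ^ n)"
  proof -
    have "(\<Prod>j<n. inverse (0 - u * (q\<^sup>2) ^ j)) = inverse (\<Prod>j<n. 0 - u * (q\<^sup>2) ^ j)"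
      using prod_inversef[of "\<lambda>j. 0 - u * (q\<^sup>2) ^ j" "{..<n}"] by (simp only: comp_def)
    then show ?thesis by (simp only: prod.distrib prod_power_root_eval[OF un(1)])
  qed
  also have "\<dots> = symm (z ^ n) - symm (u ^ n)"
  proof -
    have "(0::'a) ^ n = 0" using n3 by simp
    moreover have "(Z - U) * (inverse Z - U) * inverse (0 - U) = symm Z - symm U"
      if "Z \<noteq> 0" "U \<noteq> 0" for Z U :: 'a
      using that by (simp add: field_simps)
    ultimately show ?thesis using un z by (simp only: power_inverse) simp
  qed
  also have "symm (u ^ n) = a ^ n * inverse lam ^ n + inverse a ^ n * lam ^ n"
    by (simp add: power_divide divide_inverse power_inverse power_mult_distrib)
  finally show ?thesis by (simp add: charpoly_def power_inverse)
qed

lemma Nsub_gen_Mspace: "(\<lambda>j. del * mbasis i j - mbasis (n + i) j) \<in> (Mspace :: (nat \<Rightarrow> 'a) set)"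
  by (rule MspaceI[of "Suc (n + i)"]) (simp add: mbasis_def)

lemma Nsub_gens_Mspace:
  fixes del :: 'a
  shows "{(\<lambda>j. del * mbasis i j - mbasis (n + i) j) | i. True} \<subseteq> Mspace"
  using Nsub_gen_Mspace by auto

lemma Phi_Nsub_gen: "Phi (\<lambda>j. del * mbasis i j - mbasis (n + i) j) = - (charpoly del * E i)"
proof -
  have "(\<lambda>j. del * mbasis i j - mbasis (n + i) j) = (\<lambda>j. del * mbasis i j + (-1) * mbasis (n + i) j)"
    by simp
  moreover have "Phi \<dots> = smult del (E i) + smult (-1) (E (n + i))"
    by (simp only: Phi_add[OF subspaceD(4)[OF is_subspace_Mspace mbasis_Mspace]
          subspaceD(4)[OF is_subspace_Mspace mbasis_Mspace]] Phi_smult[OF mbasis_Mspace] Phi_mbasis)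
  moreover have "smult del (E i) + smult (-1) (E (n + i)) = - (charpoly del * E i)"
    unfolding charpoly_def newton_periodic by (simp add: algebra_simps)
  ultimately show ?thesis by (simp only:)
qed

lemma is_subspace_Nsub: "is_subspace (Nsub n (del :: 'a))"
  unfolding Nsub_def by (rule is_subspace_lspan[OF Nsub_gens_Mspace])

lemma is_subspace_dvd: "is_subspace {v \<in> Mspace. g dvd Phi v}"
  unfolding is_subspace_def
  using subspaceD[OF is_subspace_Mspace] by (auto simp: Phi_add Phi_smult dvd_smult)

lemma Nsub_eq: "Nsub n del = {v \<in> Mspace. charpoly del dvd Phi v}"
proof
  show "Nsub n del \<subseteq> {v \<in> Mspace. charpoly del dvd Phi v}"
    unfolding Nsub_def
  proof (rule lspan_least[OF is_subspace_dvd], rule subsetI)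
    fix v assume v: "v \<in> {(\<lambda>j. del * mbasis i j - mbasis (n + i) j) | i. True}"
    then obtain i where "v = (\<lambda>j. del * mbasis i j - mbasis (n + i) j)" by blast
    then have "charpoly del dvd Phi v" by (simp only: Phi_Nsub_gen dvd_minus_iff dvd_triv_left)
    then show "v \<in> {v \<in> Mspace. charpoly del dvd Phi v}" using v Nsub_gens_Mspace by blast
  qed
next
  note sub = is_subspace_Nsub[of del]
  have ex: "\<exists>v\<in>Nsub n del. Phi v = charpoly del * h" for h
  proof (rule newton_span[of "\<lambda>h. \<exists>v\<in>Nsub n del. Phi v = charpoly del * h" q a lam])
    show "\<exists>v\<in>Nsub n del. Phi v = charpoly del * 0" using subspaceD(2)[OF sub] Phi_zero by (metis mult_zero_right)
    fix f g assume fg: "\<exists>v\<in>Nsub n del. Phi v = charpoly del * f" "\<exists>v\<in>Nsub n del. Phi v = charpoly del * g"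
    from fg(1) obtain v where v: "v \<in> Nsub n del" "Phi v = charpoly del * f" by (elim bexE)
    from fg(2) obtain w where w: "w \<in> Nsub n del" "Phi w = charpoly del * g" by (elim bexE)
    have M: "v \<in> Mspace" "w \<in> Mspace" using subspaceD(1)[OF sub] v(1) w(1) by auto
    have "Phi (\<lambda>i. v i + w i) = charpoly del * (f + g)"
      unfolding Phi_add[OF M] v(2) w(2) by (simp only: distrib_left)
    then show "\<exists>v\<in>Nsub n del. Phi v = charpoly del * (f + g)"
      using subspaceD(3)[OF sub v(1) w(1)] by (rule bexI)
  next
    fix t f assume tf: "\<exists>v\<in>Nsub n del. Phi v = charpoly del * f"
    from tf obtain v where v: "v \<in> Nsub n del" "Phi v = charpoly del * f" by (elim bexE)
    have M: "v \<in> Mspace" using subspaceD(1)[OF sub] v(1) by auto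
    have "Phi (\<lambda>i. t * v i) = charpoly del * smult t f"
      unfolding Phi_smult[OF M] v(2) by (simp only: mult_smult_right)
    then show "\<exists>v\<in>Nsub n del. Phi v = charpoly del * smult t f"
      using subspaceD(4)[OF sub v(1)] by (rule bexI)
  next
    fix i
    let ?v = "\<lambda>j. del * mbasis i j - mbasis (n + i) j"
    have "?v \<in> Nsub n del" unfolding Nsub_def by (rule subsetD[OF lspan_superset]) auto
    then have mem: "(\<lambda>j. (-1) * ?v j) \<in> Nsub n del" by (rule subspaceD(4)[OF sub])
    have "Phi (\<lambda>j. (-1) * ?v j) = charpoly del * E i"
      unfolding Phi_smult[OF Nsub_gen_Mspace] Phi_Nsub_gen by simp
    then show "\<exists>v\<in>Nsub n del. Phi v = charpoly del * E i" using mem by (rule bexI)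
  qed
  show "{v \<in> Mspace. charpoly del dvd Phi v} \<subseteq> Nsub n del"
  proof safe
    fix v assume v: "v \<in> Mspace" "charpoly del dvd Phi v"
    then obtain h where "Phi v = charpoly del * h" by (elim dvdE)
    with ex[of h] obtain w where "w \<in> Nsub n del" "Phi w = Phi v" by auto
    then show "v \<in> Nsub n del" using Phi_inj[of w v] v subspaceD(1)[OF sub] by auto
  qed
qed

lemma Nsub_neq_Mspace: "Nsub n (del :: 'a) \<noteq> Mspace"
proof
  assume "Nsub n del = Mspace"
  then have "mbasis 0 \<in> Nsub n del" using mbasis_Mspace by blast
  then have "charpoly del dvd 1" unfolding Nsub_eq using Phi_mbasis[of 0] by simp
  then show False using degree_charpoly n3 by (metis degree_1 dvd_imp_degree_le not_numeral_le_zero one_neq_zero le_trans)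
qed

section \<open>Reducibility and stable factors\<close>

lemma aw_stable_imp_reducible:
  assumes g: "g dvd charpoly del" "0 < degree g" "degree g < n" and stable: "aw_stable x mu g"
  shows "\<not> W_irreducible q n a b c lam del"
proof -
  define U where "U = {v \<in> Mspace. g dvd Phi v}"
  have "is_submodule q a b c lam U"
  proof (rule is_submoduleI)
    show "is_subspace U" unfolding U_def by (rule is_subspace_dvd)
    fix v assume v: "v \<in> U"
    then show "actA q a lam v \<in> U" unfolding U_def using actA_Mspace by (simp add: Phi_actA del: mult_pCons_left)
    show "actB q a b c lam v \<in> U"
      using v actB_Mspace aw_stableD[OF stable _ aw_Phi_actB] unfolding U_def by blast
  qed
  moreover have "Nsub n del \<subseteq> U" unfolding Nsub_eq U_def using g(1) dvd_trans by blast
  moreover have "U \<noteq> Nsub n del"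
  proof
    assume eq: "U = Nsub n del"
    obtain v where v: "v \<in> Mspace" "Phi v = g" using Phi_surj by blast
    then have "v \<in> U" by (simp add: U_def)
    then have "charpoly del dvd g" using v unfolding eq Nsub_eq by simp
    then have "degree (charpoly del) \<le> degree g" using g(2) by (intro dvd_imp_degree_le) auto
    then show False using g(3) degree_charpoly by simp
  qed
  moreover have "U \<noteq> Mspace"
  proof
    assume "U = Mspace"
    then have "mbasis 0 \<in> U" using mbasis_Mspace by blast
    then have "g dvd 1" unfolding U_def using Phi_mbasis[of 0] by simp
    then show False using g(2) by (metis degree_1 dvd_imp_degree_le le_zero_eq less_irrefl one_neq_zero)
  qed
  ultimately show ?thesis unfolding W_irreducible_def by blast
qed

text \<open>A acts as multiplication by X, so a submodule becomes an ideal of F[X] and an element of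
  least degree generates it. Stability of this ideal is invariance under B, and both degree bounds
  come from U lying strictly between N and M.\<close>

lemma reducible_imp_aw_stable:
  assumes "\<not> W_irreducible q n a b c lam del"
  shows "\<exists>g. g dvd charpoly del \<and> 0 < degree g \<and> degree g < n \<and> aw_stable x mu g"
proof -
  obtain U where U: "is_submodule q a b c lam U" "Nsub n del \<subseteq> U" "U \<noteq> Nsub n del" "U \<noteq> Mspace"
    using assms Nsub_neq_Mspace unfolding W_irreducible_def by blast
  have sub: "is_subspace U" and A: "\<And>v. v \<in> U \<Longrightarrow> actA q a lam v \<in> U"
    and B: "\<And>v. v \<in> U \<Longrightarrow> actB q a b c lam v \<in> U"
    using U(1) unfolding is_submodule_def by blast+
  note UM = subspaceD(1)[OF sub]
  define I where "I = Phi ` U"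
  have I0: "0 \<in> I" unfolding I_def using subspaceD(2)[OF sub] Phi_zero by (metis imageI)
  have I_add: "f + g \<in> I" if fg: "f \<in> I" "g \<in> I" for f g
  proof -
    obtain v w where vw: "v \<in> U" "w \<in> U" "f = Phi v" "g = Phi w" using fg unfolding I_def by blast
    then have "f + g = Phi (\<lambda>i. v i + w i)" using UM by (subst Phi_add) auto
    then show ?thesis unfolding I_def using subspaceD(3)[OF sub vw(1,2)] by blast
  qed
  have I_smult: "smult t f \<in> I" if f: "f \<in> I" for t f
  proof -
    obtain v where v: "v \<in> U" "f = Phi v" using f unfolding I_def by blast
    then have "smult t f = Phi (\<lambda>i. t * v i)" using UM by (subst Phi_smult) auto
    then show ?thesis unfolding I_def using subspaceD(4)[OF sub v(1)] by blast
  qed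
  have I_X: "[:0, 1:] * f \<in> I" if f: "f \<in> I" for f
  proof -
    obtain v where v: "v \<in> U" "f = Phi v" using f unfolding I_def by blast
    then have "[:0, 1:] * f = Phi (actA q a lam v)" using UM by (subst Phi_actA) auto
    then show ?thesis unfolding I_def using A[OF v(1)] by blast
  qed
  have I_mult: "h * f \<in> I" if f: "f \<in> I" for h f
  proof (induction h)
    case 0
    then show ?case using I0 by simp
  next
    case (pCons t h)
    have "pCons t h * f = smult t f + [:0, 1:] * (h * f)" by simp
    then show ?case using I_add[OF I_smult[OF f] I_X[OF pCons(2)]] by simp
  qed
  have memI: "v \<in> U" if vI: "v \<in> Mspace" "Phi v \<in> I" for v
  proof -
    obtain w where w: "w \<in> U" "Phi v = Phi w" using vI(2) unfolding I_def by (elim imageE)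
    then have "v = w" using vI(1) UM by (intro Phi_inj) auto
    then show ?thesis using w(1) by simp
  qed
  have P_I: "charpoly del \<in> I"
  proof -
    obtain v where v: "v \<in> Mspace" "Phi v = charpoly del" using Phi_surj by blast
    then have "v \<in> Nsub n del" unfolding Nsub_eq by simp
    then show ?thesis using U(2) v unfolding I_def by (auto intro!: image_eqI)
  qed
  have P0: "charpoly del \<noteq> 0" using degree_charpoly n3 by (metis degree_0 not_numeral_le_zero)
  obtain g where g: "g \<in> I" "g \<noteq> 0" "\<And>f. f \<in> I \<Longrightarrow> f \<noteq> 0 \<Longrightarrow> degree g \<le> degree f"
    using ex_has_least_nat[of "\<lambda>f. f \<in> I \<and> f \<noteq> 0" "charpoly del" degree] P_I P0 by blast
  have g_dvd: "g dvd f" if f: "f \<in> I" for f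
  proof (rule ccontr)
    assume "\<not> g dvd f"
    then have nz: "f mod g \<noteq> 0" by (simp add: dvd_eq_mod_eq_0)
    have eq: "f mod g = f + (- (f div g)) * g" by (simp add: minus_div_mult_eq_mod[symmetric])
    have "f mod g \<in> I" unfolding eq by (rule I_add[OF f I_mult[OF g(1)]])
    then have "degree g \<le> degree (f mod g)" using nz by (rule g(3))
    then show False using degree_mod_less'[OF g(2) nz] by simp
  qed
  have "0 < degree g"
  proof (rule ccontr)
    assume "\<not> 0 < degree g"
    then obtain t where t: "g = [:t:]" by (metis degree_eq_zeroE neq0_conv)
    have "f \<in> I" for f
      using I_mult[OF g(1), of "smult (inverse t) f"] g(2) by (simp add: t)
    then have "Mspace \<subseteq> U" using memI by blast
    then show False using UM U(4) by blast
  qed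
  moreover have "degree g < n"
  proof (rule ccontr)
    assume "\<not> degree g < n"
    obtain h where h: "charpoly del = g * h" using g_dvd[OF P_I] by (elim dvdE)
    then have "n = degree g + degree h" using P0 degree_charpoly by (metis degree_mult_eq mult_eq_0_iff)
    then have "degree h = 0" using \<open>\<not> degree g < n\<close> by simp
    then obtain t where t: "h = [:t:]" by (rule degree_eq_zeroE)
    have "t \<noteq> 0" using h t P0 by auto
    then have "charpoly del dvd f" if "f \<in> I" for f
      using g_dvd[OF that] h t by (simp add: smult_dvd_iff)
    then have "U \<subseteq> Nsub n del" unfolding Nsub_eq I_def using UM by auto
    then show False using U(2,3) by blast
  qed
  moreover have "aw_stable x mu g"
    unfolding aw_stable_def
  proof (intro allI impI, elim conjE)
    fix f f' assume f: "g dvd f" "aw x mu f f'"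
    then obtain h where "f = h * g" by (metis dvdE mult.commute)
    then have "f \<in> I" using I_mult[OF g(1)] by simp
    then obtain v where v: "v \<in> U" "f = Phi v" unfolding I_def by blast
    then have "aw x mu f (Phi (actB q a b c lam v))" using aw_Phi_actB UM by auto
    then have "f' = Phi (actB q a b c lam v)" using f(2) aw_unique by blast
    then show "g dvd f'" using g_dvd B[OF v(1)] unfolding I_def by blast
  qed
  ultimately show ?thesis using g_dvd[OF P_I] by blast
qed

text \<open>B cannot lead from m_(i+1) down to m_i, so the m_j with j > i span a submodule. For
  delta = 0, N is spanned by the m_j with j \<ge> n, and i \<le> n - 2 makes the inclusion
  strict.\<close>

lemma phi_eq_0_imp_reducible:
  assumes i: "i \<le> n - 2" and lam: "lam\<^sup>2 = q ^ (2 * i)"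
  shows "\<not> W_irreducible q n a b c lam 0"
proof -
  have "inverse lam * q powi (int (Suc i) - 1) - lam * q powi (1 - int (Suc i)) = 0"
  proof -
    have e: "int (Suc i) - 1 = int i" "1 - int (Suc i) = - int i" by simp_all
    have "lam * lam = q ^ i * q ^ i" using lam by (simp add: power2_eq_square mult_2 power_add)
    then show ?thesis
      unfolding e power_int_minus power_int_of_nat using nonzero(4) by (simp add: field_simps)
  qed
  then have phi0: "phi q a b c lam (Suc i) = 0" unfolding phi_def by simp
  define U where "U = {v \<in> Mspace. \<forall>j\<le>i. v j = (0::'a)}"
  have "is_submodule q a b c lam U"
  proof (rule is_submoduleI)
    show "is_subspace U"
      unfolding is_subspace_def U_def using subspaceD[OF is_subspace_Mspace] by auto
    fix v assume v: "v \<in> U"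
    then have "actA q a lam v \<in> Mspace" "actB q a b c lam v \<in> Mspace"
      using actA_Mspace actB_Mspace unfolding U_def by blast+
    moreover have "actB q a b c lam v j = 0" if "j \<le> i" for j
      using v that phi0 by (cases "j = i") (auto simp: U_def actB_def)
    ultimately show "actA q a lam v \<in> U" "actB q a b c lam v \<in> U"
      using v unfolding U_def by (auto simp: actA_def)
  qed
  moreover have "Nsub n 0 \<subseteq> U"
    unfolding Nsub_def
  proof (rule lspan_least)
    show "is_subspace U" using calculation unfolding is_submodule_def by blast
    show "{(\<lambda>j. 0 * mbasis i j - mbasis (n + i) j) | i. True} \<subseteq> U"
      using Nsub_gens_Mspace[of 0] i n3 by (auto simp: U_def mbasis_def)
  qed
  moreover have "U \<noteq> Mspace"
  proof
    assume "U = Mspace"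
    then have "mbasis 0 \<in> U" using mbasis_Mspace by blast
    then have "mbasis 0 0 = (0::'a)" unfolding U_def by blast
    then show False by (simp add: mbasis_def)
  qed
  moreover have "U \<noteq> Nsub n 0"
  proof
    assume eq: "U = Nsub n 0"
    have "mbasis (Suc i) \<in> U" using mbasis_Mspace[of "Suc i"] by (simp add: U_def mbasis_def)
    then have "charpoly 0 dvd E (Suc i)" unfolding eq Nsub_eq by simp
    then have "degree (charpoly 0) \<le> degree (E (Suc i))" by (rule dvd_imp_degree_le) simp
    then show False using i n3 by (simp add: degree_charpoly)
  qed
  ultimately show ?thesis unfolding W_irreducible_def by blast
qed

end

section \<open>The action on parameters\<close>

lemma aw_param_nonzero:
  assumes "q \<noteq> 0" "a \<noteq> 0" "b \<noteq> 0" "c \<noteq> 0" "lam \<noteq> 0" "i < 4"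
  shows "aw_param q a b c lam i \<noteq> 0"
proof -
  have "i = 0 \<or> i = 1 \<or> i = 2 \<or> i = 3" using assms(6) by auto
  then show ?thesis using assms aw_param_simps[of q a b c lam] by auto
qed

lemma prod_less_4: "(\<Prod>i<(4::nat). t i) = (t 0 * t 1 * t 2 * t 3 :: 'a::comm_monoid_mult)"
  by (simp add: eval_nat_numeral mult_ac)

section \<open>Invariants and orbits of the equivalence\<close>

lemma quad_equiv_sym:
  assumes "quad_equiv q y z"
  shows "quad_equiv q z y"
  using assms unfolding quad_equiv_def
  by (induction rule: rtranclp_induct) (auto intro: converse_rtranclp_into_rtranclp)

lemma quad_equiv_step: "quad_equiv q y z \<Longrightarrow> gen_step q z w \<Longrightarrow> quad_equiv q y w"
  unfolding quad_equiv_def by (rule rtranclp.rtrancl_into_rtrancl) auto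

definition quad_nonzero :: "'a::field \<times> 'a \<times> 'a \<times> 'a \<Rightarrow> bool" where
  "quad_nonzero y = (case y of (a, b, c, lam) \<Rightarrow> a \<noteq> 0 \<and> b \<noteq> 0 \<and> c \<noteq> 0 \<and> lam \<noteq> 0)"

text \<open>The product of the 1 - x_i z records the four parameters without their order, and it is
  the only way in which they enter \<open>aw_term\<close>.\<close>

definition quad_invariant :: "'a::field \<Rightarrow> 'a \<times> 'a \<times> 'a \<times> 'a \<Rightarrow> ('a \<Rightarrow> 'a) \<times> 'a" where
  "quad_invariant q y = (case y of (a, b, c, lam) \<Rightarrow> (\<lambda>z. \<Prod>i<4. 1 - aw_param q a b c lam i * z, b / lam))"

text \<open>Entries 0 and 3 are unchanged by a common rescaling of the quadruple. Entries 1 and 2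
  change by s^(-2) and s^2, and s^2 = a b c lam q is precisely the quotient of b c q by 1/(a
  lam).\<close>

lemma aw_param_sqrt_step:
  fixes q a b c lam s :: "'a::field"
  assumes "q \<noteq> 0" "a \<noteq> 0" "b \<noteq> 0" "c \<noteq> 0" "lam \<noteq> 0" and s: "s * s = a * b * c * lam * q"
  shows "aw_param q (a / s) (b / s) (c / s) (lam / s) 0 = aw_param q a b c lam 0"
    "aw_param q (a / s) (b / s) (c / s) (lam / s) 1 = aw_param q a b c lam 2"
    "aw_param q (a / s) (b / s) (c / s) (lam / s) 2 = aw_param q a b c lam 1"
    "aw_param q (a / s) (b / s) (c / s) (lam / s) 3 = aw_param q a b c lam 3"
proof -
  have "s * s \<noteq> 0" using assms by simp
  then have "s \<noteq> 0" by simp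
  show "aw_param q (a / s) (b / s) (c / s) (lam / s) 1 = aw_param q a b c lam 2"
    unfolding aw_param_simps times_divide_times_eq s using assms by (simp add: field_simps s)
  show "aw_param q (a / s) (b / s) (c / s) (lam / s) 2 = aw_param q a b c lam 1"
    unfolding aw_param_simps times_divide_times_eq s using assms by (simp add: field_simps)
  show "aw_param q (a / s) (b / s) (c / s) (lam / s) 0 = aw_param q a b c lam 0"
    "aw_param q (a / s) (b / s) (c / s) (lam / s) 3 = aw_param q a b c lam 3"
    unfolding aw_param_simps using \<open>s \<noteq> 0\<close> by simp_all
qed

lemma gen_step_invariant:
  assumes "q \<noteq> 0" "gen_step q y z"
  shows "quad_nonzero y = quad_nonzero z"
    and "quad_nonzero y \<Longrightarrow> quad_invariant q y = quad_invariant q z"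
proof -
  show nz: "quad_nonzero y = quad_nonzero z"
    using assms(2)
  proof cases
    case (t23 s a b c lam)
    then show ?thesis using assms(1) by (auto simp: quad_nonzero_def)
  qed (auto simp: quad_nonzero_def)
  show "quad_invariant q y = quad_invariant q z" if "quad_nonzero y"
    using assms(2)
  proof cases
    case (sign a b c lam)
    then show ?thesis by (simp add: quad_invariant_def prod_less_4 aw_param_simps[unfolded One_nat_def])
  next
    case (t12 a b c lam)
    then show ?thesis
      by (simp add: quad_invariant_def prod_less_4 aw_param_simps[unfolded One_nat_def] divide_inverse mult_ac)
  next
    case (t34 a b c lam)
    then show ?thesis
      by (simp add: quad_invariant_def prod_less_4 aw_param_simps[unfolded One_nat_def] divide_inverse mult_ac)
  next
    case (t23 s a b c lam)
    have nz': "a \<noteq> 0" "b \<noteq> 0" "c \<noteq> 0" "lam \<noteq> 0" using that t23 by (auto simp: quad_nonzero_def)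
    then have "s * s \<noteq> 0" using t23(3) assms(1) by simp
    then show ?thesis
      unfolding t23(1,2) quad_invariant_def prod.case prod_less_4
        aw_param_sqrt_step[OF assms(1) nz' t23(3)]
      by (simp add: mult_ac)
  qed
qed

lemma quad_equiv_invariant:
  assumes "quad_equiv q y z" "q \<noteq> 0" "quad_nonzero y"
  shows "quad_nonzero z \<and> quad_invariant q y = quad_invariant q z"
  using assms(1) unfolding quad_equiv_def
proof (induction rule: rtranclp_induct)
  case base
  then show ?case using assms(3) by simp
next
  case (step z w)
  then have "gen_step q z w \<or> gen_step q w z" by auto
  then show ?case using step.IH gen_step_invariant[OF assms(2)] by metis
qed

text \<open>The generators act on the four parameters by the adjacent transpositions, the generator
  \<open>(2 3)\<close> exchanging the middle two.\<close>

definition quad_reach :: "'a::field \<Rightarrow> 'a \<times> 'a \<times> 'a \<times> 'a \<Rightarrow> 'a \<Rightarrow> 'a \<Rightarrow> 'a \<Rightarrow> 'a \<Rightarrow> bool" where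
  "quad_reach q y p0 p1 p2 p3 \<longleftrightarrow> (\<exists>a b c lam. quad_nonzero (a, b, c, lam) \<and> quad_equiv q y (a, b, c, lam)
     \<and> aw_param q a b c lam 0 = p0 \<and> aw_param q a b c lam 1 = p1
     \<and> aw_param q a b c lam 2 = p2 \<and> aw_param q a b c lam 3 = p3)"

lemma quad_reach_self:
  assumes "quad_nonzero (a, b, c, lam)"
  shows "quad_reach q (a, b, c, lam) (aw_param q a b c lam 0) (aw_param q a b c lam 1)
    (aw_param q a b c lam 2) (aw_param q a b c lam 3)"
  unfolding quad_reach_def using assms by (auto simp: quad_equiv_def)

lemma quad_reach_swap01:
  assumes "quad_reach q y p0 p1 p2 p3"
  shows "quad_reach q y p1 p0 p2 p3"
proof -
  obtain a b c lam where h: "quad_nonzero (a, b, c, lam)" "quad_equiv q y (a, b, c, lam)"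
    "aw_param q a b c lam 0 = p0" "aw_param q a b c lam 1 = p1"
    "aw_param q a b c lam 2 = p2" "aw_param q a b c lam 3 = p3"
    using assms unfolding quad_reach_def by blast
  show ?thesis
    unfolding quad_reach_def
  proof (intro exI conjI)
    show "quad_equiv q y (a, b, inverse c, lam)" by (rule quad_equiv_step[OF h(2) gen_step.t12])
  qed (use h in \<open>simp_all add: quad_nonzero_def aw_param_simps[unfolded One_nat_def] divide_inverse mult_ac\<close>)
qed

lemma quad_reach_swap23:
  assumes "quad_reach q y p0 p1 p2 p3"
  shows "quad_reach q y p0 p1 p3 p2"
proof -
  obtain a b c lam where h: "quad_nonzero (a, b, c, lam)" "quad_equiv q y (a, b, c, lam)"
    "aw_param q a b c lam 0 = p0" "aw_param q a b c lam 1 = p1"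
    "aw_param q a b c lam 2 = p2" "aw_param q a b c lam 3 = p3"
    using assms unfolding quad_reach_def by blast
  show ?thesis
    unfolding quad_reach_def
  proof (intro exI conjI)
    show "quad_equiv q y (inverse a, b, c, lam)" by (rule quad_equiv_step[OF h(2) gen_step.t34])
  qed (use h in \<open>simp_all add: quad_nonzero_def aw_param_simps[unfolded One_nat_def] divide_inverse mult_ac\<close>)
qed

lemma quad_reach_swap12:
  fixes q :: "'a::field"
  assumes "alg_closed_field TYPE('a)" "q \<noteq> 0" "quad_reach q y p0 p1 p2 p3"
  shows "quad_reach q y p0 p2 p1 p3"
proof -
  obtain a b c lam where h: "quad_nonzero (a, b, c, lam)" "quad_equiv q y (a, b, c, lam)"
    "aw_param q a b c lam 0 = p0" "aw_param q a b c lam 1 = p1"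
    "aw_param q a b c lam 2 = p2" "aw_param q a b c lam 3 = p3"
    using assms unfolding quad_reach_def by blast
  have nz: "a \<noteq> 0" "b \<noteq> 0" "c \<noteq> 0" "lam \<noteq> 0" using h(1) by (auto simp: quad_nonzero_def)
  have "degree [:- (a * b * c * lam * q), 0, 1:] \<noteq> 0" by simp
  then obtain s where "poly [:- (a * b * c * lam * q), 0, 1:] s = 0"
    using assms(1) unfolding alg_closed_field_def by blast
  then have s: "s * s = a * b * c * lam * q" by simp
  then have "s * s \<noteq> 0" using nz assms(2) by simp
  then have "quad_nonzero (a / s, b / s, c / s, lam / s)" using nz by (auto simp: quad_nonzero_def)
  then show ?thesis
    unfolding quad_reach_def
    using quad_equiv_step[OF h(2) gen_step.t23[OF s]] h(3-) aw_param_sqrt_step[OF assms(2) nz s]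
    by metis
qed

lemma quad_reach_pair:
  fixes q :: "'a::field" and p :: "nat \<Rightarrow> 'a"
  assumes ac: "alg_closed_field TYPE('a)" "q \<noteq> 0" and r: "quad_reach q y (p 0) (p 1) (p 2) (p 3)"
    and ij: "i < 4" "j < 4" "i \<noteq> j"
  shows "\<exists>r s. quad_reach q y r s (p i) (p j)"
proof -
  note s01 = quad_reach_swap01 and s12 = quad_reach_swap12[OF ac] and s23 = quad_reach_swap23
  \<comment> \<open>A final swap of the last two entries fixes the order, so only the six unordered
    pairs of positions need a word in the adjacent transpositions.\<close>
  have "\<exists>r s. quad_reach q y r s (p i) (p j) \<or> quad_reach q y r s (p j) (p i)"
  proof -
    consider "{i, j} = {2, 3}" | "{i, j} = {1, 3}" | "{i, j} = {0, 3}"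
      | "{i, j} = {1, 2}" | "{i, j} = {0, 2}" | "{i, j} = {0, 1}"
    proof -
      have "i = 0 \<or> i = 1 \<or> i = 2 \<or> i = 3" "j = 0 \<or> j = 1 \<or> j = 2 \<or> j = 3" using ij by auto
      then show ?thesis using that ij(3) by (elim disjE) (simp_all add: insert_commute)
    qed
    then show ?thesis
    proof cases
      case 1
      then show ?thesis using r by (auto simp: doubleton_eq_iff)
    next
      case 2
      then show ?thesis using s12[OF r] by (auto simp: doubleton_eq_iff)
    next
      case 3
      then show ?thesis using s12[OF s01[OF r]] by (auto simp: doubleton_eq_iff)
    next
      case 4
      then show ?thesis using s12[OF s23[OF r]] by (auto simp: doubleton_eq_iff)
    next
      case 5
      then show ?thesis using s12[OF s23[OF s01[OF r]]] by (auto simp: doubleton_eq_iff)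
    next
      case 6
      then show ?thesis using s12[OF s23[OF s01[OF s12[OF r]]]] by (auto simp: doubleton_eq_iff)
    qed
  qed
  then show ?thesis using s23 by blast
qed

text \<open>The order of q^2 is d / gcd(d, 2), and d = 1, 2, 4 are exactly the cases where it is
  below 3.\<close>

lemma primitive_root_square:
  fixes q :: "'a::field"
  assumes ac: "alg_closed_field TYPE('a)" and q: "root_of_unity_order q d" and d: "d \<notin> {1, 2, 4}"
  shows "primitive_root (q\<^sup>2) (dprime d)"
proof
  have d0: "0 < d" "q ^ d = 1" and ord: "\<And>k. 0 < k \<Longrightarrow> k < d \<Longrightarrow> q ^ k \<noteq> 1"
    using q unfolding root_of_unity_order_def by auto
  show "alg_closed_field TYPE('a)" by (rule ac)
  show "3 \<le> dprime d"
  proof (cases "even d")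
    case True
    then obtain m where "d = 2 * m" by (elim evenE)
    then show ?thesis using d d0 True by (auto simp: dprime_def)
  next
    case False
    then have "d \<noteq> 0" "d \<noteq> 1" "d \<noteq> 2" using d d0(1) by auto
    then have "3 \<le> d" by arith
    then show ?thesis using False by (simp add: dprime_def)
  qed
  show "(q\<^sup>2) ^ dprime d = 1"
    using d0 by (auto simp: dprime_def mult.commute power_mult[symmetric]) (simp add: power_mult)
  fix k assume k: "0 < k" "k < dprime d"
  show "(q\<^sup>2) ^ k \<noteq> 1"
  proof
    assume "(q\<^sup>2) ^ k = 1"
    then have e: "q ^ (2 * k) = 1" by (simp add: power_mult)
    show False
    proof (cases "2 * k < d")
      case True
      then show False using ord[of "2 * k"] k e by simp
    next
      case False
      \<comment> \<open>Only odd d leaves room for an exponent 2 k of at least d; subtracting d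
        brings it into the forbidden range, since 2 k is even and differs from d.\<close>
      then have odd: "odd d" "k < d" using k by (auto simp: dprime_def split: if_splits)
      then have "2 * k \<noteq> d" by auto
      then have lt: "d < 2 * k" "2 * k - d < d" using False odd by auto
      have "q ^ (2 * k) = q ^ d * q ^ (2 * k - d)" using lt by (simp flip: power_add)
      then show False using ord[of "2 * k - d"] lt e d0 by simp
    qed
  qed
qed

lemma (in primitive_root) aw_stable_cong:
  assumes "\<And>z. (\<Prod>i<4. 1 - x i * z) = (\<Prod>i<4. 1 - y i * z)"
  shows "aw_stable x \<mu> g = aw_stable y \<mu> g"
proof -
  have "aw_term x = aw_term y" unfolding aw_term_def[abs_def] assms ..
  then show ?thesis unfolding aw_stable_def aw_def by simp
qed

theorem theorem1p11:
  fixes q a b c lam del :: "'a::field" and d :: nat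
  assumes "alg_closed_field TYPE('a)"
    and "root_of_unity_order q d"
    and "d \<notin> {1, 2, 4}"
    and "a \<noteq> 0" "b \<noteq> 0" "c \<noteq> 0" "lam \<noteq> 0"
  shows "W_irreducible q (dprime d) a b c lam del \<longleftrightarrow>
    (\<forall>a' b' c' lam' del'. a' \<noteq> 0 \<and> b' \<noteq> 0 \<and> c' \<noteq> 0 \<and> lam' \<noteq> 0 \<and>
        quint_equiv q (dprime d) (a', b', c', lam', del') (a, b, c, lam, del) \<longrightarrow>
        del' \<noteq> 0 \<or> lam' ^ 2 \<notin> {q ^ (2 * i) | i. i \<le> dprime d - 2})"
    (is "?irr \<longleftrightarrow> ?cond")
proof -
  define n where "n = dprime d"
  interpret primitive_root "q\<^sup>2" n
    unfolding n_def using assms(1-3) by (rule primitive_root_square)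
  interpret W: askey_wilson q n a b c lam
    by unfold_locales (use assms in auto)
  let ?x = "aw_param q a b c lam"
  let ?k = "del + a ^ n * inverse lam ^ n + inverse a ^ n * lam ^ n"
  have nz: "quad_nonzero (a, b, c, lam)" using assms by (simp add: quad_nonzero_def)
  show ?thesis
  proof
    assume irr: ?irr
    show ?cond
    proof (intro allI impI, elim conjE, rule ccontr)
      fix a' b' c' lam' del'
      assume nz': "a' \<noteq> 0" "b' \<noteq> 0" "c' \<noteq> 0" "lam' \<noteq> 0"
        and eq: "quint_equiv q (dprime d) (a', b', c', lam', del') (a, b, c, lam, del)"
        and "\<not> (del' \<noteq> 0 \<or> lam' ^ 2 \<notin> {q ^ (2 * i) | i. i \<le> dprime d - 2})"
      then obtain i where del': "del' = 0" and i: "i \<le> n - 2" "lam'\<^sup>2 = q ^ (2 * i)"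
        by (auto simp: n_def)
      interpret W': askey_wilson q n a' b' c' lam'
        by unfold_locales (use nz' in auto)
      \<comment> \<open>The submodule is transported as a polynomial factor and not as a set of
        vectors: the Newton bases of the two quadruples differ, while the polynomial ring and the
        operator on it are shared.\<close>
      obtain g where g: "g dvd W'.charpoly 0" "0 < degree g" "degree g < n"
        "aw_stable (aw_param q a' b' c' lam') (b' / lam') g"
        using W'.reducible_imp_aw_stable[OF W'.phi_eq_0_imp_reducible[OF i]] by blast
      have inv: "quad_invariant q (a', b', c', lam') = quad_invariant q (a, b, c, lam)"
        and k: "0 + a' ^ n * inverse lam' ^ n + inverse a' ^ n * lam' ^ n = ?k"
        using eq quad_equiv_invariant[of q "(a', b', c', lam')" "(a, b, c, lam)"] nz'
        unfolding quint_equiv_def by (simp_all add: del' n_def quad_nonzero_def)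
      \<comment> \<open>Both take the value z^n + z^(-n) - kappa at z + 1/z, and the second
        condition of the equivalence says that kappa is the same.\<close>
      have "W'.charpoly 0 = W.charpoly del"
      proof (rule poly_eqI_symm)
        fix z assume "regular z"
        then have z: "z \<noteq> 0" by (simp add: regular_def)
        show "poly (W'.charpoly 0) (symm z) = poly (W.charpoly del) (symm z)"
          unfolding W'.poly_charpoly_symm[OF z] W.poly_charpoly_symm[OF z] k ..
      qed
      moreover have "b' / lam' = b / lam"
        "\<And>z. (\<Prod>i<4. 1 - aw_param q a' b' c' lam' i * z) = (\<Prod>i<4. 1 - ?x i * z)"
        using inv unfolding quad_invariant_def by (auto dest: fun_cong)
      then have "aw_stable ?x (b / lam) g"
        using g(4) aw_stable_cong[of "aw_param q a' b' c' lam'" ?x] by simp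
      ultimately have "\<not> W_irreducible q n a b c lam del"
        using g by (intro W.aw_stable_imp_reducible) simp_all
      then show False using irr by (simp add: n_def)
    qed
  next
    assume cond: ?cond
    show ?irr
    proof (rule ccontr)
      assume "\<not> ?irr"
      then obtain g where g: "g dvd W.charpoly del" "0 < degree g" "degree g < n"
        "aw_stable ?x (b / lam) g"
        using W.reducible_imp_aw_stable by (auto simp: n_def)
      have mu: "b / lam \<noteq> 0" using assms by simp
      have x: "?x i \<noteq> 0" if "i < 4" for i using assms that by (intro aw_param_nonzero) auto
      from aw_stable_imp_pair[OF g(4) mu W.aw_total x W.poly_charpoly_symm g(1-3) W.degree_charpoly]
      obtain i j k where ij: "i < 4" "j < 4" "i \<noteq> j" "?x i ^ n + inverse (?x i) ^ n = ?k"
        and k: "k \<le> n - 2" "?x i * ?x j * (q\<^sup>2) ^ k = 1" by blast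
      \<comment> \<open>x_i goes to the last position, which holds a' / lam', because x_i is the
        entry known to satisfy the condition on kappa.\<close>
      obtain r s where "quad_reach q (a, b, c, lam) r s (?x j) (?x i)"
        using quad_reach_pair[OF assms(1) W.q_nonzero quad_reach_self[OF nz] ij(2,1)] ij(3) by blast
      then obtain a' b' c' lam' where nz': "quad_nonzero (a', b', c', lam')"
        and equiv: "quad_equiv q (a, b, c, lam) (a', b', c', lam')"
        and x': "inverse (a' * lam') = ?x j" "a' / lam' = ?x i"
        unfolding quad_reach_def aw_param_simps(3,4) by metis
      have nz'': "a' \<noteq> 0" "b' \<noteq> 0" "c' \<noteq> 0" "lam' \<noteq> 0" using nz' by (auto simp: quad_nonzero_def)
      \<comment> \<open>The terms in a' and lam' already add up to kappa, so delta' = 0 is the value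
        that completes an equivalent quintuple.\<close>
      have "a' ^ n * inverse lam' ^ n + inverse a' ^ n * lam' ^ n = ?k"
        unfolding ij(4)[symmetric] x'(2)[symmetric]
        by (simp add: power_divide divide_inverse power_inverse power_mult_distrib)
      then have "quint_equiv q (dprime d) (a', b', c', lam', 0) (a, b, c, lam, del)"
        using quad_equiv_sym[OF equiv] by (simp add: quint_equiv_def n_def)
      moreover have "?x i * ?x j = inverse (lam'\<^sup>2)"
        unfolding x'[symmetric] using nz'' by (simp add: field_simps power2_eq_square)
      then have "inverse (lam'\<^sup>2) * (q\<^sup>2) ^ k = 1" using k(2) by simp
      then have "lam' ^ 2 = q ^ (2 * k)"
        using nz'' by (simp add: power_mult inverse_eq_divide)
      ultimately show False
        using cond nz'' k(1) unfolding n_def by blast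
    qed
  qed
qed

end
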